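(* Fix $0<\beta<\alpha<1$. There is a sequence $(\mathcal{A}_N)_{N\ge1}$ of algorithms, where $\mathcal{A}_N$ is an $N$-sample algorithm (depending only on $N,\alpha,\beta$, and not on $\eta$ or the reservoir), such that for every $\eta\in(0,1)$ and every sequence $(\mu_N)_{N\ge1}$ of reservoir distributions with $G_{\mu_N}^{-1}(1-\eta)\ge\alpha$ for all $N$, letting $a_{i^*}$ denote the output of $\mathcal{A}_N$ run on reservoir $\mu_N$, \[ \limsup_{N\to\infty}\frac{\big(-\log\mathbb{P}[p_{i^*}<\beta]\big)\cdot\log^2 N}{N}\ \ge\ c_{\alpha,\beta}, \qquad c_{\alpha,\beta}=\frac{\big(\arccos(1-2\alpha)-\arccos(1-2\beta)\big)^2}{2}=\frac12\Big(\int_\beta^\alpha\frac{dx}{\sqrt{x(1-x)}}\Big)^2 . \]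
   Context: Infinite-armed Bernoulli bandit: a reservoir distribution $\mu$ is any Borel probability measure on $[0,1]$. There are countably many arms $a_1,a_2,\dots$ whose means $p_1,p_2,\dots$ are drawn i.i.d. from $\mu$ (unknown to the algorithm). Each time arm $a_i$ is sampled it returns a reward in $\{0,1\}$ distributed as Bernoulli$(p_i)$, independently of all other rewards given the means. An algorithm, at each step, chooses (based on previously observed rewards and possibly internal randomness) an arm to sample, and at the end outputs an arm index $i^*$. An $N$-sample algorithm is one that takes exactly $N$ samples almost surely and then outputs $i^*$. Probabilities are over the means, rewards and algorithm randomness. $G_\mu(\tau)=\mu([0,\tau])$ and $G_\mu^{-1}(p)=\inf\{\tau:G_\mu(\tau)\ge p\}$. *)

theory Defs
  imports "HOL-Probability.Probability"
begin

text \<open>A history is the list of (sampled arm index, observed reward) pairs.\<close>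
type_synonym hist = "(nat \<times> bool) list"

text \<open>A (randomized, adaptive) algorithm: a rule choosing the next arm (a distribution
  over arm indices) from the history so far, and a rule choosing the output arm
  from the final history.  Internal randomness is modelled by these distributions
  (behavioural strategies; equivalent to shared randomness by perfect recall).\<close>
type_synonym alg = "(hist \<Rightarrow> nat pmf) \<times> (hist \<Rightarrow> nat pmf)"

definition next_arm :: "alg \<Rightarrow> hist \<Rightarrow> nat pmf" where
  "next_arm A = fst A"

definition output_arm :: "alg \<Rightarrow> hist \<Rightarrow> nat pmf" where
  "output_arm A = snd A"

primrec run :: "alg \<Rightarrow> (nat \<Rightarrow> real) \<Rightarrow> nat \<Rightarrow> hist pmf" where
  "run A p 0 = return_pmf []"
| "run A p (Suc n) =
     bind_pmf (run A p n) (\<lambda>h. bind_pmf (next_arm A h)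
       (\<lambda>a. map_pmf (\<lambda>r. h @ [(a, r)]) (bernoulli_pmf (p a))))"

definition output_dist :: "alg \<Rightarrow> (nat \<Rightarrow> real) \<Rightarrow> nat \<Rightarrow> nat pmf" where
  "output_dist A p N = bind_pmf (run A p N) (output_arm A)"

definition reservoir :: "real measure \<Rightarrow> bool" where
  "reservoir \<mu> \<longleftrightarrow> prob_space \<mu> \<and> sets \<mu> = sets borel \<and> measure \<mu> {0..1} = 1"

definition G :: "real measure \<Rightarrow> real \<Rightarrow> real" where
  "G \<mu> \<tau> = measure \<mu> {0..\<tau>}"

definition Ginv :: "real measure \<Rightarrow> real \<Rightarrow> real" where
  "Ginv \<mu> q = Inf {\<tau>. G \<mu> \<tau> \<ge> q}"

definition fail_prob :: "alg \<Rightarrow> real measure \<Rightarrow> nat \<Rightarrow> real \<Rightarrow> real" where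
  "fail_prob A \<mu> N \<beta> =
     (\<integral>p. measure_pmf.prob (output_dist A p N) {i. p i < \<beta>} \<partial>(PiM UNIV (\<lambda>_. \<mu>)))"

definition neglog :: "real \<Rightarrow> ereal" where
  "neglog x = (if x = 0 then \<infinity> else ereal (- ln x))"

definition c_const :: "real \<Rightarrow> real \<Rightarrow> real" where
  "c_const \<alpha> \<beta> = (arccos (1 - 2 * \<alpha>) - arccos (1 - 2 * \<beta>))\<^sup>2 / 2"

end

theory Submission
  imports Defs "HOL-Real_Asymp.Real_Asymp"
begin

text \<open>
  Arms are examined one after another; an arm is discarded for ever as soon as its number of
  successes after \<open>n\<close> samples falls below a threshold, and the arm in hand at the end is output.
  Let \<open>\<tau>\<close> be the number of samples spent on an arm. If, averaged over the reservoir,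
  \<open>exp (\<kappa> \<tau>)\<close> over the event of rejection, plus \<open>exp (\<kappa> j)\<close> over the event that a bad arm is still alive
  after \<open>j\<close> samples, is at most 1 for all \<open>j \<le> N\<close>, then the failure probability is at most
  \<open>exp (- \<kappa> N)\<close>.

  The threshold is \<open>n \<theta>(n)\<close> where \<open>\<theta>\<close> descends from nearly \<open>\<alpha>\<close> to nearly \<open>\<beta>\<close> linearly in \<open>ln n\<close>, in the
  arcsine coordinate that makes the Fisher information constant. With \<open>D\<close> the distance from \<open>\<alpha>\<close>
  to \<open>\<beta>\<close> in this coordinate and speed \<open>d = D / ln N\<close>, the threshold is concave in \<open>n\<close>, so the
  cheapest way to be alive up to time \<open>n\<close> is to follow it, at a relative entropy of about
  \<open>d\<^sup>2 / 2\<close> per sample whatever the mean of the arm. This gives \<open>\<kappa>\<close> of order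
  \<open>D\<^sup>2 / (2 (ln N)\<^sup>2)\<close> with a constant bound \<open>K\<close> in place of 1. Demanding \<open>m\<close> successes in a row first,
  with \<open>m\<close> a constant, makes the good arms, whose expectation is below 1, outweigh the excess \<open>K\<close>.
\<close>

section \<open>Sequential rejection policies\<close>

text \<open>A state \<open>(i, n, k)\<close> records the current arm, its number of samples and its number of successes.\<close>

definition advance :: "(nat \<Rightarrow> real) \<Rightarrow> nat \<times> nat \<times> nat \<Rightarrow> bool \<Rightarrow> nat \<times> nat \<times> nat" where
  "advance c s r = (case s of (i, n, k) \<Rightarrow>
     if real (k + of_bool r) < c (Suc n) then (Suc i, 0, 0) else (i, Suc n, k + of_bool r))"

definition arm_state :: "(nat \<Rightarrow> real) \<Rightarrow> hist \<Rightarrow> nat \<times> nat \<times> nat" where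
  "arm_state c h = foldl (\<lambda>s x. advance c s (snd x)) (0, 0, 0) h"

definition policy :: "(nat \<Rightarrow> real) \<Rightarrow> alg" where
  "policy c = (\<lambda>h. return_pmf (fst (arm_state c h)), \<lambda>h. return_pmf (fst (arm_state c h)))"

text \<open>\<^const>\<open>bernoulli_pmf\<close> silently truncates its parameter to the unit interval.\<close>

definition clip :: "real \<Rightarrow> real" where
  "clip x = max 0 (min 1 x)"

lemma clip_bounds: "0 \<le> clip x" "clip x \<le> 1"
  by (auto simp: clip_def)

lemma clip_id: "0 \<le> x \<Longrightarrow> x \<le> 1 \<Longrightarrow> clip x = x"
  by (auto simp: clip_def)

lemma bernoulli_pmf_clip: "bernoulli_pmf p = bernoulli_pmf (clip p)"
proof -
  have "pmf (bernoulli_pmf p) b = pmf (bernoulli_pmf (clip p)) b" for b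
    by (simp add: bernoulli_pmf.rep_eq clip_def)
  from this show ?thesis by (rule pmf_eqI)
qed

lemma nn_integral_bernoulli_clip:
  "(\<integral>\<^sup>+x. f x \<partial>measure_pmf (bernoulli_pmf p)) = f True * ennreal (clip p) + f False * ennreal (1 - clip p)"
  unfolding bernoulli_pmf_clip[of p] by (subst nn_integral_bernoulli_pmf) (simp_all add: clip_bounds)

text \<open>Conditional failure probability given the means \<open>p\<close>, with \<open>j\<close>
  samples still to be drawn from state \<open>s\<close>. As a backward recursion it needs the state
  only, not the whole history.\<close>

primrec lose :: "(nat \<Rightarrow> real) \<Rightarrow> real \<Rightarrow> (nat \<Rightarrow> real) \<Rightarrow> nat \<Rightarrow> nat \<times> nat \<times> nat \<Rightarrow> real" where
  "lose c \<beta> p 0 s = of_bool (p (fst s) < \<beta>)"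
| "lose c \<beta> p (Suc j) s =
     clip (p (fst s)) * lose c \<beta> p j (advance c s True) +
     (1 - clip (p (fst s))) * lose c \<beta> p j (advance c s False)"

lemma lose_bounds: "0 \<le> lose c \<beta> p j s \<and> lose c \<beta> p j s \<le> 1"
proof (induction j arbitrary: s)
  case (Suc j)
  have "clip (p (fst s)) * lose c \<beta> p j (advance c s True) +
     (1 - clip (p (fst s))) * lose c \<beta> p j (advance c s False) \<le> 
     clip (p (fst s)) * 1 + (1 - clip (p (fst s))) * 1"
    using Suc clip_bounds by (intro add_mono mult_left_mono) auto
  then show ?case using Suc clip_bounds by auto
qed auto

text \<open>Arms are never revisited, so from arm \<open>Suc i\<close> on the mean of arm 0 is
  invisible. This is the regeneration property behind the renewal argument.\<close>

lemma lose_shift: "lose c \<beta> (case_nat q p) j (Suc i, n, k) = lose c \<beta> p j (i, n, k)"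
  by (induction j arbitrary: i n k) (auto simp: advance_def)

text \<open>\<open>run\<close> peels off the last sample and \<open>lose\<close> the next one, so
  the expected value of \<open>lose\<close> depends on \<open>n + j\<close> only. Keeping
  \<open>j\<close> general moves one sample across in each induction step.\<close>

lemma run_policy_lose:
  "(\<integral>\<^sup>+h. ennreal (lose c \<beta> p j (arm_state c h)) \<partial>measure_pmf (run (policy c) p n)) =
   ennreal (lose c \<beta> p (n + j) (0, 0, 0))"
proof (induction n arbitrary: j)
  case 0
  then show ?case by (simp add: arm_state_def)
next
  case (Suc n)
  have step: "lose c \<beta> p j (advance c s True) * ennreal (clip x) + lose c \<beta> p j (advance c s False) * ennreal (1 - clip x) =
      ennreal (clip x * lose c \<beta> p j (advance c s True) + (1 - clip x) * lose c \<beta> p j (advance c s False))" for s x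
    using lose_bounds[of c \<beta> p j "advance c s True"] lose_bounds[of c \<beta> p j "advance c s False"] clip_bounds[of x]
    by (subst ennreal_plus) (auto simp: ennreal_mult mult.commute)
  have "(\<integral>\<^sup>+h. ennreal (lose c \<beta> p j (arm_state c h)) \<partial>measure_pmf (run (policy c) p (Suc n))) =
    (\<integral>\<^sup>+h. ennreal (lose c \<beta> p (Suc j) (arm_state c h)) \<partial>measure_pmf (run (policy c) p n))"
    unfolding run.simps lose.simps policy_def next_arm_def fst_conv nn_integral_bind_pmf bind_return_pmf
      nn_integral_map_pmf nn_integral_bernoulli_clip step[symmetric]
    by (simp add: arm_state_def)
  then show ?case using Suc[of "Suc j"] by simp
qed

lemma output_policy_lose:
  "measure_pmf.prob (output_dist (policy c) p N) {i. p i < \<beta>} = lose c \<beta> p N (0, 0, 0)"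
proof -
  have "emeasure (measure_pmf (output_dist (policy c) p N)) {i. p i < \<beta>} =
     (\<integral>\<^sup>+h. ennreal (lose c \<beta> p 0 (arm_state c h)) \<partial>measure_pmf (run (policy c) p N))"
    unfolding output_dist_def policy_def output_arm_def
    by (subst emeasure_bind_pmf) (auto intro!: nn_integral_cong simp: indicator_def)
  then show ?thesis
    using lose_bounds[of c \<beta> p N] unfolding run_policy_lose
    by (simp add: measure_pmf.emeasure_eq_measure)
qed

text \<open>\<open>tilt c \<kappa> \<beta> q j n k\<close> is the expectation of \<open>exp (\<kappa> \<tau>)\<close> as above for an arm of mean \<open>q\<close> in state \<open>(n, k)\<close>
  with \<open>j\<close> samples to go.\<close>

primrec tilt :: "(nat \<Rightarrow> real) \<Rightarrow> real \<Rightarrow> real \<Rightarrow> real \<Rightarrow> nat \<Rightarrow> nat \<Rightarrow> nat \<Rightarrow> real" where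
  "tilt c \<kappa> \<beta> q 0 n k = exp (\<kappa> * n) * of_bool (q < \<beta>)"
| "tilt c \<kappa> \<beta> q (Suc j) n k =
     q * (if real (k + 1) < c (Suc n) then exp (\<kappa> * Suc n) else tilt c \<kappa> \<beta> q j (Suc n) (k + 1)) +
     (1 - q) * (if real k < c (Suc n) then exp (\<kappa> * Suc n) else tilt c \<kappa> \<beta> q j (Suc n) k)"

section \<open>Renewal at rejections, averaged over the reservoir\<close>

context
  fixes \<mu> :: "real measure" and c :: "nat \<Rightarrow> real" and \<beta> :: real
  assumes \<mu>: "reservoir \<mu>"
begin

abbreviation "means \<equiv> PiM (UNIV :: nat set) (\<lambda>_. \<mu>)"

interpretation M: prob_space \<mu> using \<mu> by (simp add: reservoir_def)
interpretation P: sequence_space \<mu> by standard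
interpretation MS: pair_prob_space \<mu> means by standard

lemma sets_reservoir [measurable_cong]: "sets \<mu> = sets borel"
  using \<mu> by (simp add: reservoir_def)

lemma measurable_lose [measurable]: "(\<lambda>p. lose c \<beta> p j s) \<in> borel_measurable means"
proof (induction j arbitrary: s)
  case 0
  have [measurable]: "(\<lambda>p. p (fst s)) \<in> borel_measurable means"
    using measurable_component_singleton[of "fst s" UNIV "\<lambda>_. \<mu>"] measurable_cong_sets[OF refl sets_reservoir] by auto
  show ?case by simp
next
  case (Suc j)
  have [measurable]: "(\<lambda>p. p (fst s)) \<in> borel_measurable means"
    using measurable_component_singleton[of "fst s" UNIV "\<lambda>_. \<mu>"] measurable_cong_sets[OF refl sets_reservoir] by auto
  note [measurable] = Suc
  show ?case unfolding lose.simps clip_def by measurable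
qed

definition lose_mean :: "nat \<Rightarrow> real" where
  "lose_mean j = (\<integral>p. lose c \<beta> p j (0, 0, 0) \<partial>means)"

text \<open>Failure probability given that the arm in hand has mean \<open>q\<close>, with all later
  means integrated out. The arm in hand may have index 0 because of
  \<open>lose_shift\<close>.\<close>

definition lose_given :: "nat \<Rightarrow> nat \<Rightarrow> nat \<Rightarrow> real \<Rightarrow> real" where
  "lose_given j n k q = (\<integral>p. lose c \<beta> (case_nat q p) j (0, n, k) \<partial>means)"

lemma measurable_case_nat_fixed: "(\<lambda>p. case_nat q p) \<in> measurable means means"
proof -
  have "space \<mu> = UNIV" using sets_eq_imp_space_eq[OF sets_reservoir] by simp
  then have "q \<in> space \<mu>" by simp
  then have [measurable]: "(\<lambda>p. q) \<in> measurable means \<mu>" by simp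
  show ?thesis by measurable
qed

lemma integrable_lose_given:
  "integrable means (\<lambda>p. lose c \<beta> (case_nat q p) j s)"
  using lose_bounds measurable_compose[OF measurable_case_nat_fixed measurable_lose]
  by (intro P.integrable_const_bound[of _ 1]) auto

text \<open>A rejection moves on to arm 1, where \<open>lose_shift\<close> removes \<open>q\<close>:
  the process restarts with a fresh i.i.d. sequence and \<open>j\<close> samples.\<close>

lemma lose_given_Suc:
  assumes "0 \<le> q" "q \<le> 1"
  shows "lose_given (Suc j) n k q =
     q * (if real (k + 1) < c (Suc n) then lose_mean j else lose_given j (Suc n) (k + 1) q) +
     (1 - q) * (if real k < c (Suc n) then lose_mean j else lose_given j (Suc n) k q)"
  using integrable_lose_given assms
  by (simp add: lose_given_def lose_mean_def clip_id lose_shift advance_def)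

text \<open>An i.i.d. sequence has the law of an independent draw put in front of an i.i.d.
  sequence; Fubini applies since \<open>lose\<close> is bounded.\<close>

lemma lose_mean_eq:
  "integrable \<mu> (lose_given j 0 0)" "lose_mean j = (\<integral>q. lose_given j 0 0 q \<partial>\<mu>)"
proof -
  have int: "integrable (\<mu> \<Otimes>\<^sub>M means) (\<lambda>(q, p). lose c \<beta> (case_nat q p) j (0, 0, 0))"
    using lose_bounds by (intro MS.integrable_const_bound[of _ 1]) (auto simp: split_beta')
  show "integrable \<mu> (lose_given j 0 0)"
    unfolding lose_given_def using MS.integrable_fst[OF int] .
  have "lose_mean j = (\<integral>p. lose c \<beta> p j (0, 0, 0) \<partial>distr (\<mu> \<Otimes>\<^sub>M means) means (\<lambda>(q, p). case_nat q p))"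
    unfolding lose_mean_def P.PiM_iter ..
  also have "\<dots> = (\<integral>x. (\<lambda>(q, p). lose c \<beta> (case_nat q p) j (0, 0, 0)) x \<partial>(\<mu> \<Otimes>\<^sub>M means))"
    by (subst integral_distr) (auto simp: split_beta')
  also have "\<dots> = (\<integral>q. lose_given j 0 0 q \<partial>\<mu>)"
    unfolding lose_given_def using MS.integral_fst[OF int] by simp
  finally show "lose_mean j = (\<integral>q. lose_given j 0 0 q \<partial>\<mu>)" .
qed

text \<open>A rejection after \<tau> samples leaves a budget of j + n - \<tau>, hence a failure
  probability of at most exp (-\<kappa> (j + n)) * exp (\<kappa> \<tau>). The first factor is common
  to all outcomes and \<open>tilt\<close> averages the second.\<close>

lemma lose_given_le_tilt:
  assumes "0 \<le> q" "q \<le> 1" "\<And>i. i < j \<Longrightarrow> lose_mean i \<le> exp (- \<kappa> * i)"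
  shows "lose_given j n k q \<le> exp (- \<kappa> * (j + n)) * tilt c \<kappa> \<beta> q j n k"
  using assms(3)
proof (induction j arbitrary: n k)
  case 0
  have "lose_given 0 n k q = of_bool (q < \<beta>)"
    using P.P.prob_space by (simp add: lose_given_def)
  also have "\<dots> = exp (- \<kappa> * n) * (exp (\<kappa> * n) * of_bool (q < \<beta>))"
    by (simp flip: exp_add mult.assoc)
  finally show ?case by simp
next
  case (Suc j)
  have IH: "lose_given j n k q \<le> exp (- \<kappa> * (j + n)) * tilt c \<kappa> \<beta> q j n k" for n k
    using Suc by simp
  have F: "lose_mean j \<le> exp (- \<kappa> * (Suc j + n)) * exp (\<kappa> * Suc n)"
    using Suc.prems[of j] by (simp add: algebra_simps flip: exp_add)
  have step: "(if b then lose_mean j else lose_given j (Suc n) k' q) \<le>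
     exp (- \<kappa> * (Suc j + n)) * (if b then exp (\<kappa> * Suc n) else tilt c \<kappa> \<beta> q j (Suc n) k')" for b k'
    using F IH[of "Suc n" k'] by (auto simp: algebra_simps)
  have "lose_given (Suc j) n k q \<le>
     q * (exp (- \<kappa> * (Suc j + n)) * (if real (k + 1) < c (Suc n) then exp (\<kappa> * Suc n) else tilt c \<kappa> \<beta> q j (Suc n) (k + 1))) +
     (1 - q) * (exp (- \<kappa> * (Suc j + n)) * (if real k < c (Suc n) then exp (\<kappa> * Suc n) else tilt c \<kappa> \<beta> q j (Suc n) k))"
    unfolding lose_given_Suc[OF assms(1,2)] using assms(1,2)
    by (intro add_mono mult_left_mono step) auto
  also have "\<dots> = exp (- \<kappa> * (Suc j + n)) * tilt c \<kappa> \<beta> q (Suc j) n k"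
    by (simp add: algebra_simps)
  finally show ?case unfolding of_nat_add .
qed

text \<open>Strong induction, as a rejection may leave any smaller budget. Averaging
  \<open>lose_given_le_tilt\<close> over the reservoir gives the factor
  \<open>a - b * \<eta>\<close> at most, because arms of mean at least \<alpha> have mass at least
  \<eta>.\<close>

lemma lose_mean_le:
  assumes tilt: "\<And>q j. 0 \<le> q \<Longrightarrow> q \<le> 1 \<Longrightarrow> j \<le> N \<Longrightarrow> tilt c \<kappa> \<beta> q j 0 0 \<le> a - b * of_bool (\<alpha> \<le> q)"
    and "0 \<le> b" "\<eta> \<le> measure \<mu> {\<alpha>..}" "a - b * \<eta> \<le> 1" "j \<le> N"
  shows "lose_mean j \<le> exp (- \<kappa> * j)"
  using \<open>j \<le> N\<close>
proof (induction j rule: less_induct)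
  case (less j)
  have "AE q in \<mu>. q \<in> {0..1}"
    using \<mu> by (intro M.AE_prob_1) (auto simp: reservoir_def)
  then have *: "AE q in \<mu>. lose_given j 0 0 q \<le> exp (- \<kappa> * j) * (a - b * indicator {\<alpha>..} q)"
  proof eventually_elim
    case (elim q)
    have "lose_given j 0 0 q \<le> exp (- \<kappa> * j) * tilt c \<kappa> \<beta> q j 0 0"
      using elim less lose_given_le_tilt[of q j \<kappa> 0 0] by auto
    also have "\<dots> \<le> exp (- \<kappa> * j) * (a - b * indicator {\<alpha>..} q)"
      using tilt[of q j] elim less by (intro mult_left_mono) (auto simp: indicator_def of_bool_def)
    finally show ?case .
  qed
  have [measurable]: "{\<alpha>..} \<in> sets \<mu>" by (simp add: sets_reservoir)
  have int: "integrable \<mu> (indicator {\<alpha>..} :: real \<Rightarrow> real)"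
    by (intro M.integrable_const_bound[of _ 1]) auto
  have "lose_mean j \<le> (\<integral>q. exp (- \<kappa> * j) * (a - b * indicator {\<alpha>..} q) \<partial>\<mu>)"
    unfolding lose_mean_eq(2) by (intro integral_mono_AE lose_mean_eq(1) *) (use int in auto)
  also have "\<dots> = exp (- \<kappa> * j) * (a - b * measure \<mu> {\<alpha>..})"
    using int using M.prob_space by (simp add: sets_eq_imp_space_eq[OF sets_reservoir])
  also have "\<dots> \<le> exp (- \<kappa> * j) * 1"
    using assms(3,4) mult_left_mono[OF assms(3,2)] by (intro mult_left_mono) auto
  finally show ?case by simp
qed

lemma fail_prob_policy: "fail_prob (policy c) \<mu> N \<beta> = lose_mean N"
  unfolding fail_prob_def lose_mean_def output_policy_lose ..

end

lemma reservoir_good_mass: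
  assumes "reservoir \<mu>" "Ginv \<mu> (1 - \<eta>) \<ge> \<alpha>" "\<eta> < 1"
  shows "\<eta> \<le> measure \<mu> {\<alpha>..}"
proof -
  interpret prob_space \<mu> using assms by (simp add: reservoir_def)
  have sets: "sets \<mu> = sets borel" using assms by (simp add: reservoir_def)
  then have space: "space \<mu> = UNIV" using sets_eq_imp_space_eq[OF sets] by simp
  have below: "measure \<mu> {0..\<tau>} < 1 - \<eta>" if "\<tau> < \<alpha>" for \<tau>
  proof (rule ccontr)
    assume "\<not> ?thesis"
    then have "\<tau> \<in> {\<tau>. G \<mu> \<tau> \<ge> 1 - \<eta>}" by (simp add: G_def)
    \<comment> \<open>\<open>Inf\<close> is a lower bound only for a set bounded below. Negative
      \<tau> do not belong to it: there the interval is empty, while 1 - \<eta> is positive.\<close>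
    moreover have "bdd_below {\<tau>. G \<mu> \<tau> \<ge> 1 - \<eta>}"
    proof (rule bdd_belowI[of _ 0])
      fix x assume "x \<in> {\<tau>. G \<mu> \<tau> \<ge> 1 - \<eta>}"
      then show "0 \<le> x" using assms(3) by (cases "x < 0") (auto simp: G_def)
    qed
    ultimately have "Ginv \<mu> (1 - \<eta>) \<le> \<tau>" unfolding Ginv_def by (rule cInf_lower)
    then show False using that assms by simp
  qed
  \<comment> \<open>Continuity from below passes from closed intervals to
    \<open>{0..<\<alpha>}\<close>, so an atom at \<alpha> counts as good.\<close>
  have "(\<lambda>n. measure \<mu> {0..\<alpha> - 1 / real (Suc n)}) \<longlonglongrightarrow> measure \<mu> (\<Union>n. {0..\<alpha> - 1 / real (Suc n)})"
    by (intro finite_Lim_measure_incseq) (auto simp: sets incseq_def frac_le)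
  moreover have "(\<Union>n. {0..\<alpha> - 1 / real (Suc n)}) = {0..<\<alpha>}"
  proof (intro set_eqI iffI)
    fix x assume "x \<in> {0..<\<alpha>}"
    then obtain n where "inverse (real (Suc n)) < \<alpha> - x"
      using reals_Archimedean[of "\<alpha> - x"] by auto
    then show "x \<in> (\<Union>n. {0..\<alpha> - 1 / real (Suc n)})"
      using \<open>x \<in> {0..<\<alpha>}\<close> by (auto intro!: exI[of _ n] simp: field_simps)
  next
    fix x assume "x \<in> (\<Union>n. {0..\<alpha> - 1 / real (Suc n)})"
    then obtain n where "0 \<le> x" "x \<le> \<alpha> - 1 / real (Suc n)" by auto
    moreover have "0 < 1 / real (Suc n)" by simp
    ultimately show "x \<in> {0..<\<alpha>}" unfolding atLeastLessThan_iff by linarith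
  qed
  ultimately have "(\<lambda>n. measure \<mu> {0..\<alpha> - 1 / real (Suc n)}) \<longlonglongrightarrow> measure \<mu> {0..<\<alpha>}" by simp
  then have 1: "measure \<mu> {0..<\<alpha>} \<le> 1 - \<eta>"
    by (rule LIMSEQ_le_const2) (use below in \<open>auto intro!: exI[of _ 0] less_imp_le\<close>)
  have "1 \<le> measure \<mu> ({0..<\<alpha>} \<union> {\<alpha>..})"
  proof -
    have "1 = measure \<mu> {0..1}" using assms by (simp add: reservoir_def)
    also have "\<dots> \<le> measure \<mu> ({0..<\<alpha>} \<union> {\<alpha>..})"
      by (intro finite_measure_mono) (auto simp: sets)
    finally show ?thesis .
  qed
  also have "\<dots> \<le> measure \<mu> {0..<\<alpha>} + measure \<mu> {\<alpha>..}"
    by (intro measure_Un_le) (auto simp: sets)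
  finally show ?thesis using 1 by simp
qed

section \<open>Exponential moments of a single arm\<close>

definition kl :: "real \<Rightarrow> real \<Rightarrow> real" where
  "kl a b = a * ln (a / b) + (1 - a) * ln ((1 - a) / (1 - b))"

definition bin_entropy :: "real \<Rightarrow> real" where
  "bin_entropy x = - x * ln x - (1 - x) * ln (1 - x)"

definition log_odds :: "real \<Rightarrow> real" where
  "log_odds x = ln (x / (1 - x))"

text \<open>Likelihood of one particular path with \<open>k\<close> successes in \<open>n\<close>
  samples, hence without a binomial coefficient.\<close>

definition weight :: "real \<Rightarrow> nat \<Rightarrow> nat \<Rightarrow> real" where
  "weight q n k = q ^ k * (1 - q) ^ (n - k)"

lemma weight_Suc:
  assumes "k \<le> n"
  shows "weight q (Suc n) (Suc k) = q * weight q n k" "weight q (Suc n) k = (1 - q) * weight q n k"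
  using assms by (simp_all add: weight_def Suc_diff_le)

lemma weight_nonneg: "0 \<le> q \<Longrightarrow> q \<le> 1 \<Longrightarrow> 0 \<le> weight q n k"
  by (simp add: weight_def)

lemma log_odds_mono: "0 < x \<Longrightarrow> x \<le> y \<Longrightarrow> y < 1 \<Longrightarrow> log_odds x \<le> log_odds y"
  unfolding log_odds_def by (intro ln_mono divide_pos_pos frac_le) auto

lemma kl_strict_pos:
  assumes "0 < a" "a < 1" "0 < b" "b < 1" "a \<noteq> b"
  shows "0 < kl a b"
proof -
  have "ln (b / a) < b / a - 1"
  proof -
    have "ln (b / a) \<noteq> b / a - 1" using assms ln_eq_minus_one[of "b / a"] by auto
    then show ?thesis using ln_le_minus_one[of "b / a"] assms by auto
  qed
  then have "a * ln (b / a) < a * (b / a - 1)" using assms by simp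
  moreover have "(1 - a) * ln ((1 - b) / (1 - a)) \<le> (1 - a) * ((1 - b) / (1 - a) - 1)"
    using assms by (intro mult_left_mono ln_le_minus_one) auto
  moreover have "ln (a / b) = - ln (b / a)" "ln ((1 - a) / (1 - b)) = - ln ((1 - b) / (1 - a))"
    using assms by (simp_all add: ln_div)
  moreover have "a * (b / a - 1) + (1 - a) * ((1 - b) / (1 - a) - 1) = 0"
    using assms by (simp add: field_simps)
  ultimately show ?thesis unfolding kl_def by (simp add: algebra_simps)
qed

lemma kl_nonneg:
  assumes "0 < a" "a < 1" "0 < b" "b < 1"
  shows "0 \<le> kl a b"
  using kl_strict_pos[OF assms] assms by (cases "a = b") (auto simp: kl_def)

lemma kl_cross_entropy:
  assumes "0 < a" "a < 1" "0 < b" "b < 1"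
  shows "kl a b = - a * ln b - (1 - a) * ln (1 - b) - bin_entropy a"
  using assms by (simp add: kl_def bin_entropy_def ln_div algebra_simps)

lemma weight_exp:
  assumes "0 < q" "q < 1" "k \<le> n"
  shows "weight q n k = exp (k * ln q + (n - real k) * ln (1 - q))"
  using assms by (simp add: weight_def exp_add exp_of_nat_mult flip: of_nat_diff)

text \<open>The log-likelihood is affine in \<open>k\<close> with slope \<open>log_odds q\<close>,
  and at \<open>k = n * t\<close> it equals -n times the sum of \<open>bin_entropy t\<close> and
  \<open>kl t q\<close>. The relative entropy is dropped.\<close>

lemma weight_le_entropy:
  assumes "0 < q" "q < 1" "k \<le> n" "0 < t" "t < 1"
  shows "weight q n k \<le> exp (- real n * bin_entropy t + (k - n * t) * log_odds q)"
proof -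
  have "k * ln q + (n - real k) * ln (1 - q) =
      - real n * bin_entropy t - n * kl t q + (k - n * t) * log_odds q"
    using assms by (simp add: kl_cross_entropy log_odds_def ln_div algebra_simps)
  moreover have "0 \<le> n * kl t q" using kl_nonneg[of t q] assms by simp
  ultimately show ?thesis using assms by (simp add: weight_exp)
qed

text \<open>The log-likelihood ratio of \<open>b\<close> against \<open>a\<close> increases in
  \<open>k\<close> and equals \<open>- n * kl a b\<close> at \<open>k = a * n\<close>.\<close>

lemma weight_le_kl:
  assumes "0 < a" "a \<le> b" "b < 1" "k \<le> n" "k \<le> a * n"
  shows "weight b n k \<le> exp (- real n * kl a b) * weight a n k"
proof -
  have "(k - a * n) * (log_odds b - log_odds a) \<le> 0"
    using assms log_odds_mono[of a b] by (intro mult_nonpos_nonneg) auto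
  moreover have "k * ln b + (n - real k) * ln (1 - b) =
      - real n * kl a b + (k * ln a + (n - real k) * ln (1 - a)) + (k - a * n) * (log_odds b - log_odds a)"
    using assms by (simp add: kl_def log_odds_def ln_div algebra_simps)
  ultimately show ?thesis
    using assms by (simp add: weight_exp flip: exp_add)
qed

lemma weight_le_kl_ge:
  assumes "0 < a" "a < b" "b < 1" "b \<le> q" "q \<le> 1" "0 < n" "k \<le> n" "k \<le> a * n"
  shows "weight q n k \<le> exp (- real n * kl a b) * weight a n k"
proof (cases "q = 1")
  case True
  have "a * n < n" using assms by simp
  then have "k < n" using assms by linarith
  then show ?thesis using True assms by (simp add: weight_def zero_power)
next
  case False
  have "a * n \<le> b * n" using assms by (intro mult_right_mono) auto
  then have "k \<le> b * n" using assms by linarith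
  then have "weight q n k \<le> exp (- real n * kl b q) * weight b n k"
    using assms False by (intro weight_le_kl) auto
  also have "\<dots> \<le> 1 * weight b n k"
    using assms False kl_nonneg[of b q] weight_nonneg[of b n k] by (intro mult_right_mono) auto
  also have "\<dots> \<le> exp (- real n * kl a b) * weight a n k"
    using assms weight_le_kl[of a b k n] by simp
  finally show ?thesis .
qed

text \<open>Backward induction with a supermartingale on the tree of paths. The mass
  \<open>G\<close> of a living node dominates the total \<open>G'\<close> of its two successors, and
  a surviving successor keeps at least \<open>G\<close>. Where a path ends, \<open>K\<close> times
  the mass dominates its likelihood times exp (\<kappa> \<tau>). Likelihoods keep \<open>q\<close>
  out of the condition \<open>split\<close>.\<close>

lemma tilt_le_certificate:
  fixes B :: "nat \<Rightarrow> real" and G G' :: "nat \<Rightarrow> nat \<Rightarrow> real" and q \<kappa> \<beta> K :: real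
  assumes q: "0 \<le> q" "q \<le> 1"
    and split: "\<And>n k. n < N \<Longrightarrow> k \<le> n \<Longrightarrow> B n \<le> k \<Longrightarrow> G' (Suc n) (Suc k) + G' (Suc n) k \<le> G n k"
    and alive: "\<And>n k. 0 < n \<Longrightarrow> n \<le> N \<Longrightarrow> B n \<le> k \<Longrightarrow> G n k \<le> G' n k"
    and reject: "\<And>n k k'. n < N \<Longrightarrow> k \<le> n \<Longrightarrow> B n \<le> k \<Longrightarrow> k' = k \<or> k' = Suc k \<Longrightarrow> k' < B (Suc n) \<Longrightarrow>
       weight q (Suc n) k' * exp (\<kappa> * Suc n) \<le> K * G' (Suc n) k'"
    and last: "\<And>n k. n \<le> N \<Longrightarrow> k \<le> n \<Longrightarrow> B n \<le> k \<Longrightarrow> q < \<beta> \<Longrightarrow> weight q n k * exp (\<kappa> * n) \<le> K * G n k"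
    and nonneg: "0 \<le> K" "\<And>n k. 0 \<le> G n k"
    and "n + j \<le> N" "k \<le> n" "B n \<le> k"
  shows "weight q n k * tilt B \<kappa> \<beta> q j n k \<le> K * G n k"
  using assms(9-)
proof (induction j arbitrary: n k)
  case 0
  then show ?case using last[of n k] nonneg by (cases "q < \<beta>") auto
next
  case (Suc j)
  have step: "weight q (Suc n) k' * (if real k' < B (Suc n) then exp (\<kappa> * Suc n) else tilt B \<kappa> \<beta> q j (Suc n) k')
      \<le> K * G' (Suc n) k'" if "k' = k \<or> k' = Suc k" for k'
  proof (cases "real k' < B (Suc n)")
    case True
    then show ?thesis using reject[OF _ _ _ that] Suc.prems by simp
  next
    case False
    then have "weight q (Suc n) k' * tilt B \<kappa> \<beta> q j (Suc n) k' \<le> K * G (Suc n) k'"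
      using Suc.prems that by (intro Suc.IH) auto
    also have "\<dots> \<le> K * G' (Suc n) k'"
      using False Suc.prems nonneg by (intro mult_left_mono alive) auto
    finally show ?thesis using False by simp
  qed
  have "weight q n k * tilt B \<kappa> \<beta> q (Suc j) n k =
      weight q (Suc n) (Suc k) * (if real (Suc k) < B (Suc n) then exp (\<kappa> * Suc n) else tilt B \<kappa> \<beta> q j (Suc n) (Suc k)) +
      weight q (Suc n) k * (if real k < B (Suc n) then exp (\<kappa> * Suc n) else tilt B \<kappa> \<beta> q j (Suc n) k)"
    unfolding weight_Suc[OF \<open>k \<le> n\<close>] tilt.simps by (simp add: algebra_simps)
  also have "\<dots> \<le> K * G' (Suc n) (Suc k) + K * G' (Suc n) k"
    by (intro add_mono step) auto
  also have "\<dots> \<le> K * G n k"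
    using split[of n k] Suc.prems mult_left_mono[OF _ nonneg(1)] by (simp flip: distrib_left)
  finally show ?case .
qed

text \<open>The certificate is the likelihood under mean \<open>a\<close>. A rejected path lies
  below \<open>a * n\<close>, where \<open>q\<close> is less likely than \<open>a\<close> by exp (-
  n * kl a b). Half of this exponent pays for exp (\<kappa> n), and the other half keeps the bound
  below 1.\<close>

lemma tilt_high:
  fixes a b q \<beta> \<kappa> :: real
  assumes ab: "0 < a" "a < b" "b < 1" "b \<le> q" "q \<le> 1" "\<beta> \<le> b"
    and B: "B 0 = 0" "\<And>n. 0 < n \<Longrightarrow> n \<le> N \<Longrightarrow> B n \<le> a * n"
    and \<kappa>: "\<kappa> \<le> kl a b / 2" and "j \<le> N"
  shows "tilt B \<kappa> \<beta> q j 0 0 \<le> exp (- kl a b / 2)"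
proof -
  have "weight q 0 0 * tilt B \<kappa> \<beta> q j 0 0 \<le> exp (- kl a b / 2) * weight a 0 0"
  proof (rule tilt_le_certificate[where N = N and n = 0 and k = 0 and B = B and q = q and \<beta> = \<beta> and \<kappa> = \<kappa> and j = j
       and K = "exp (- kl a b / 2)" and G = "weight a" and G' = "weight a"])
    fix n k :: nat assume "k \<le> n"
    then show "weight a (Suc n) (Suc k) + weight a (Suc n) k \<le> weight a n k"
      by (simp add: weight_Suc algebra_simps)
  next
    fix n k k' :: nat assume *: "n < N" "k \<le> n" "B n \<le> k" "k' = k \<or> k' = Suc k" "k' < B (Suc n)"
    have "k' \<le> a * Suc n" using B(2)[of "Suc n"] * by simp
    then have "weight q (Suc n) k' * exp (\<kappa> * Suc n) \<le>
        (exp (- real (Suc n) * kl a b) * weight a (Suc n) k') * exp (\<kappa> * Suc n)"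
      using * ab by (intro mult_right_mono weight_le_kl_ge) auto
    also have "\<dots> = exp (real (Suc n) * (\<kappa> - kl a b)) * weight a (Suc n) k'"
      by (simp add: exp_add exp_diff exp_minus field_simps)
    also have "\<dots> \<le> exp (- kl a b / 2) * weight a (Suc n) k'"
    proof -
      have "0 < kl a b" using kl_strict_pos[of a b] ab by auto
      \<comment> \<open>The bracket is negative, so the worst rejection time is the first
        sample.\<close>
      then have "real (Suc n) * (\<kappa> - kl a b) \<le> 1 * (\<kappa> - kl a b)"
        using \<kappa> by (intro mult_right_mono_neg) auto
      also have "\<dots> \<le> - kl a b / 2" using \<kappa> by simp
      finally have "exp (real (Suc n) * (\<kappa> - kl a b)) \<le> exp (- kl a b / 2)" by (simp only: exp_le_cancel_iff)
      then show ?thesis using ab by (intro mult_right_mono weight_nonneg) auto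
    qed
    finally show "weight q (Suc n) k' * exp (\<kappa> * Suc n) \<le> exp (- kl a b / 2) * weight a (Suc n) k'" .
  qed (use assms weight_nonneg in auto)
  then show ?thesis by (simp add: weight_def)
qed

text \<open>A sample centred at \<open>u\<close> and tilted by \<open>log_odds u\<close> recovers
  the two Bernoulli probabilities; this makes the certificate of \<open>tilt_low\<close> split
  exactly.\<close>

lemma log_odds_entropy:
  assumes "0 < u" "u < 1"
  shows "exp (- u * log_odds u - bin_entropy u) = 1 - u"
    and "exp ((1 - u) * log_odds u - bin_entropy u) = u"
proof -
  have "- u * log_odds u - bin_entropy u = ln (1 - u)" "(1 - u) * log_odds u - bin_entropy u = ln u"
    using assms by (simp_all add: log_odds_def bin_entropy_def ln_div algebra_simps)
  then show "exp (- u * log_odds u - bin_entropy u) = 1 - u"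
    "exp ((1 - u) * log_odds u - bin_entropy u) = u" using assms by simp_all
qed

text \<open>The arm is compared with samples of success probabilities \<open>u 1, u 2, ...\<close>,
  whose mean path is the threshold. At the threshold the likelihood under \<open>q\<close> is at
  most exp (- n * bin_entropy (B n / n)), while the comparison likelihood is exp (- H n); by
  \<open>gain\<close> the ratio pays for exp (\<kappa> n) up to exp C. Successes in excess of the
  threshold favour \<open>u\<close> over a bad arm, and at a rejection the excess is
  bounded.\<close>

lemma tilt_low:
  fixes u :: "nat \<Rightarrow> real" and a b q \<beta> \<kappa> C :: real
  defines "B \<equiv> \<lambda>n. \<Sum>s=1..n. u s"
  assumes q: "0 \<le> q" "q \<le> b" "b < 1" and \<beta>: "0 < \<beta>" "\<beta> < 1" and a: "a < 1"
    and u: "\<And>n. 1 \<le> n \<Longrightarrow> n \<le> Suc N \<Longrightarrow> \<beta> \<le> u n \<and> u n \<le> a"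
    and dec: "\<And>n. 1 \<le> n \<Longrightarrow> n \<le> N \<Longrightarrow> u (Suc n) \<le> u n"
    and gain: "\<And>n. 1 \<le> n \<Longrightarrow> n \<le> N \<Longrightarrow>
       \<kappa> * n - C \<le> n * bin_entropy (B n / n) - (\<Sum>s=1..n. bin_entropy (u s))"
    and C: "0 \<le> C" and \<kappa>: "0 \<le> \<kappa>" "\<kappa> \<le> 1" and "j \<le> N"
  shows "tilt B \<kappa> \<beta> q j 0 0 \<le> exp (C + 1 + \<bar>log_odds b\<bar> + \<bar>log_odds \<beta>\<bar>) / (1 - a)" (is "_ \<le> ?K")
proof -
  define H where "H n = (\<Sum>s=1..n. bin_entropy (u s))" for n
  \<comment> \<open>\<open>G'\<close> bounds from below the likelihood under success probabilities \<open>u 1, \<dots>, u n\<close> of every path above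
    \<open>B\<close> that ends in \<open>(n, k)\<close>: summation by parts, as the log odds of \<open>u\<close> decrease.\<close>
  define G where "G n k = exp ((k - B n) * log_odds (u (Suc n)) - H n)" for n and k :: nat
  define G' where "G' n k = exp ((k - B n) * log_odds (u n) - H n)" for n and k :: nat
  have B0: "B 0 = 0" and BS: "B (Suc n) = B n + u (Suc n)" for n by (simp_all add: B_def)
  have H0: "H 0 = 0" and HS: "H (Suc n) = H n + bin_entropy (u (Suc n))" for n by (simp_all add: H_def)
  have Blow: "\<beta> * n \<le> B n" and Bup: "B n \<le> a * n" if "n \<le> N" for n
  proof -
    have "(\<Sum>s=1..n. \<beta>) \<le> B n" "B n \<le> (\<Sum>s=1..n. a)"
      unfolding B_def using u that by (intro sum_mono; force)+
    then show "\<beta> * n \<le> B n" "B n \<le> a * n" by (simp_all add: mult.commute)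
  qed
  have weight: "weight r n k * exp (\<kappa> * n) \<le> exp (C + (k - B n) * L - H n)"
    if nk: "n \<le> N" "k \<le> n" "B n \<le> k" and r: "0 \<le> r" "r < 1" "0 < r \<Longrightarrow> log_odds r \<le> L" for r n k L
  proof (cases "n = 0")
    case True
    then show ?thesis using nk C by (simp add: weight_def B0 H0)
  next
    case False
    then have pos: "0 < B n" using Blow[of n] nk \<beta> mult_pos_pos[of \<beta> "real n"] by linarith
    show ?thesis
    \<comment> \<open>The entropy bound needs \<open>0 < r\<close>. For \<open>r = 0\<close> the
      likelihood vanishes, as a path above the positive threshold contains a success.\<close>
    proof (cases "r = 0")
      case True
      have "k \<noteq> 0" using pos nk by auto
      then show ?thesis using True by (simp add: weight_def zero_power)
    next
      case False
      have t: "0 < B n / n" "B n / n < 1"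
      proof -
        show "0 < B n / n" using pos \<open>n \<noteq> 0\<close> by simp
        have "a * n < n" using a \<open>n \<noteq> 0\<close> by simp
        then have "B n < n" using Bup[of n] nk by linarith
        then show "B n / n < 1" using \<open>n \<noteq> 0\<close> by (simp add: divide_simps)
      qed
      have "weight r n k \<le> exp (- real n * bin_entropy (B n / n) + (k - n * (B n / n)) * log_odds r)"
        using False r nk t by (intro weight_le_entropy) auto
      moreover have "(k - n * (B n / n)) * log_odds r \<le> (k - B n) * L"
        using \<open>n \<noteq> 0\<close> nk r False by (auto intro!: mult_left_mono)
      moreover have "\<kappa> * n - C \<le> n * bin_entropy (B n / n) - H n"
        using gain[of n] \<open>n \<noteq> 0\<close> nk by (simp add: H_def)
      ultimately have "weight r n k \<le> exp (C + (k - B n) * L - H n - \<kappa> * n)"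
        by (smt (verit) exp_le_cancel_iff mult_minus_left)
      then have "weight r n k * exp (\<kappa> * n) \<le> exp (C + (k - B n) * L - H n - \<kappa> * n) * exp (\<kappa> * n)"
        by (intro mult_right_mono) auto
      then show ?thesis by (simp flip: exp_add)
    qed
  qed
  have lo: "log_odds \<beta> \<le> log_odds (u (Suc n))" if "n \<le> N" for n
    using u[of "Suc n"] that \<beta> a by (intro log_odds_mono) auto
  have K1: "1 \<le> 1 / (1 - a)" using u[of 1] \<beta> a by simp
  have G'split: "G' (Suc n) (Suc k) = u (Suc n) * G n k" "G' (Suc n) k = (1 - u (Suc n)) * G n k" if "n \<le> N" for n k
  proof -
    have v: "0 < u (Suc n)" "u (Suc n) < 1" using u[of "Suc n"] that \<beta> a by auto
    have "G' (Suc n) (Suc k) = exp ((1 - u (Suc n)) * log_odds (u (Suc n)) - bin_entropy (u (Suc n))) * G n k"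
      unfolding G_def G'_def BS HS by (simp add: algebra_simps flip: exp_add)
    then show "G' (Suc n) (Suc k) = u (Suc n) * G n k" by (simp only: log_odds_entropy[OF v])
    have "G' (Suc n) k = exp (- u (Suc n) * log_odds (u (Suc n)) - bin_entropy (u (Suc n))) * G n k"
      unfolding G_def G'_def BS HS by (simp add: algebra_simps flip: exp_add)
    then show "G' (Suc n) k = (1 - u (Suc n)) * G n k" by (simp only: log_odds_entropy[OF v])
  qed
  have "weight q 0 0 * tilt B \<kappa> \<beta> q j 0 0 \<le> ?K * G 0 0"
  proof (rule tilt_le_certificate[where N = N and G = G and G' = G'])
    fix n k :: nat assume "n < N"
    then show "G' (Suc n) (Suc k) + G' (Suc n) k \<le> G n k"
      using G'split[of n k] by (simp add: algebra_simps)
  next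
    fix n k :: nat assume *: "0 < n" "n \<le> N" "B n \<le> real k"
    have "log_odds (u (Suc n)) \<le> log_odds (u n)"
      using dec[of n] u[of n] u[of "Suc n"] * \<beta> a by (intro log_odds_mono) auto
    then show "G n k \<le> G' n k" using * by (auto simp: G_def G'_def intro!: mult_left_mono)
  next
    fix n k :: nat assume *: "n \<le> N" "k \<le> n" "B n \<le> real k" "q < \<beta>"
    have "weight q n k * exp (\<kappa> * n) \<le> exp (C + (k - B n) * log_odds (u (Suc n)) - H n)"
    proof (rule weight)
      assume "0 < q"
      then have "log_odds q \<le> log_odds \<beta>" using * \<beta> by (intro log_odds_mono) auto
      then show "log_odds q \<le> log_odds (u (Suc n))" using lo[of n] * by simp
    qed (use * q in auto)
    also have "\<dots> = exp C * 1 * G n k" unfolding G_def by (simp flip: exp_add)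
    also have "\<dots> \<le> (exp (C + 1 + \<bar>log_odds b\<bar> + \<bar>log_odds \<beta>\<bar>) * (1 / (1 - a))) * G n k"
      using K1 by (intro mult_right_mono mult_mono) (auto simp: G_def)
    finally show "weight q n k * exp (\<kappa> * n) \<le> ?K * G n k" by simp
  next
    fix n k k' :: nat assume *: "n < N" "k \<le> n" "B n \<le> real k" "k' = k \<or> k' = Suc k" "real k' < B (Suc n)"
    have v: "0 < u (Suc n)" "u (Suc n) < 1" "u (Suc n) \<le> a" using u[of "Suc n"] * \<beta> a by auto
    \<comment> \<open>A success gains more than the threshold does, so only a failure can reject.
      The excess \<open>k - B n\<close> before it is then below 1, and replacing one log odds by
      another costs a constant factor.\<close>
    then have k': "k' = k" using * unfolding BS by auto
    have d: "0 \<le> k - B n" "k - B n \<le> 1" using * v unfolding BS k' by auto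
    have "weight q (Suc n) k' * exp (\<kappa> * Suc n) = (1 - q) * (weight q n k * exp (\<kappa> * n)) * exp \<kappa>"
      using * by (simp add: k' weight_Suc algebra_simps exp_add)
    \<comment> \<open>The bound \<open>weight\<close> is applied just before the rejecting sample;
      that sample contributes exp \<kappa>, at most exp 1.\<close>
    also have "\<dots> \<le> 1 * exp (C + (k - B n) * \<bar>log_odds b\<bar> - H n) * exp 1"
    proof (intro mult_mono weight)
      assume "0 < q"
      then show "log_odds q \<le> \<bar>log_odds b\<bar>" using log_odds_mono[of q b] q by simp
    qed (use q \<kappa> * weight_nonneg[of q n k] in auto)
    also have "\<dots> = exp (C + 1 + (k - B n) * \<bar>log_odds b\<bar> - H n)" by (simp flip: exp_add)
    also have "\<dots> \<le> exp (C + 1 + \<bar>log_odds b\<bar> + \<bar>log_odds \<beta>\<bar> + (k - B n) * log_odds (u (Suc n)) - H n)"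
    proof -
      have "(k - B n) * \<bar>log_odds b\<bar> \<le> 1 * \<bar>log_odds b\<bar>" using d by (intro mult_right_mono) auto
      moreover have "(k - B n) * \<bar>log_odds \<beta>\<bar> \<le> 1 * \<bar>log_odds \<beta>\<bar>" using d by (intro mult_right_mono) auto
      moreover have "(k - B n) * (- \<bar>log_odds \<beta>\<bar>) \<le> (k - B n) * log_odds (u (Suc n))"
        using d lo[of n] * by (intro mult_left_mono) auto
      ultimately show ?thesis by auto
    qed
    also have "\<dots> = exp (C + 1 + \<bar>log_odds b\<bar> + \<bar>log_odds \<beta>\<bar>) * G n k"
      unfolding G_def by (simp flip: exp_add)
    \<comment> \<open>The failure leaves the fraction \<open>1 - u (Suc n)\<close> of the mass, at
      least \<open>1 - a\<close>; hence the denominator of the constant.\<close>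
    also have "\<dots> \<le> exp (C + 1 + \<bar>log_odds b\<bar> + \<bar>log_odds \<beta>\<bar>) * ((1 - u (Suc n)) / (1 - a) * G n k)"
    proof (intro mult_left_mono)
      have "1 \<le> (1 - u (Suc n)) / (1 - a)" using v a by (simp add: divide_simps)
      then have "1 * G n k \<le> (1 - u (Suc n)) / (1 - a) * G n k"
        by (intro mult_right_mono) (auto simp: G_def)
      then show "G n k \<le> (1 - u (Suc n)) / (1 - a) * G n k" by simp
    qed auto
    finally show "weight q (Suc n) k' * exp (\<kappa> * Suc n) \<le> ?K * G' (Suc n) k'"
      using G'split(2)[of n k] * by (simp add: k')
  qed (use q a \<open>j \<le> N\<close> in \<open>auto simp: G_def B0\<close>)
  then show ?thesis by (simp add: weight_def G_def B0 H0)
qed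

text \<open>The first \<open>m\<close> samples must all be successes and are then forgotten.\<close>

definition run_in :: "nat \<Rightarrow> (nat \<Rightarrow> real) \<Rightarrow> nat \<Rightarrow> real" where
  "run_in m B n = (if n \<le> m then real n else m + B (n - m))"

text \<open>Beyond the run-in the threshold is \<open>B\<close> translated by \<open>m\<close> in
  both coordinates; only the time already spent leaves a trace.\<close>

lemma tilt_run_in_shift:
  fixes \<kappa> :: real
  shows
  "tilt (run_in m B) \<kappa> \<beta> q j (m + n) (m + k) = exp (\<kappa> * m) * tilt B \<kappa> \<beta> q j n k"
proof (induction j arbitrary: n k)
  case 0
  then show ?case by (simp add: algebra_simps exp_add)
next
  case (Suc j)
  have thr: "run_in m B (Suc (m + n)) = m + B (Suc n)"
    by (simp add: run_in_def Suc_diff_le)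
  have e: "exp (\<kappa> * Suc (m + n)) = exp (\<kappa> * m) * exp (\<kappa> * Suc n)"
    by (simp add: algebra_simps flip: exp_add)
  show ?case
    using Suc[of "Suc n" k] Suc[of "Suc n" "Suc k"]
    unfolding tilt.simps thr e by (simp add: algebra_simps)
qed

text \<open>The \<open>i\<close> remaining successes occur with probability q^i; an earlier failure
  costs at most exp (\<kappa> m). If the budget ends during the run-in with a bad arm in hand,
  \<open>1 \<le> X\<close> covers the contribution.\<close>

lemma tilt_run_in:
  fixes q \<beta> \<kappa> X :: real
  assumes q: "0 \<le> q" "q \<le> 1" and \<kappa>: "0 \<le> \<kappa>"
    and X: "\<And>j. j \<le> N \<Longrightarrow> tilt B \<kappa> \<beta> q j 0 0 \<le> X" "0 \<le> X" "q < \<beta> \<Longrightarrow> 1 \<le> X"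
    and "n + i = m" "j \<le> N"
  shows "tilt (run_in m B) \<kappa> \<beta> q j n n \<le> exp (\<kappa> * m) * (1 - q ^ i + q ^ i * X)"
  using assms(7,8)
proof (induction i arbitrary: n j)
  case 0
  then show ?case using tilt_run_in_shift[of m B \<kappa> \<beta> q j 0 0] X by simp
next
  case (Suc i)
  have pw: "0 \<le> q ^ Suc i" "q ^ Suc i \<le> 1" using q by (auto intro: power_le_one simp del: power_Suc)
  have le: "exp (\<kappa> * n') \<le> exp (\<kappa> * m)" if "n' \<le> m" for n'
    using \<kappa> that by (simp add: mult_left_mono)
  show ?case
  proof (cases j)
    case 0
    have "exp (\<kappa> * n) * of_bool (q < \<beta>) \<le> exp (\<kappa> * m) * (1 - q ^ Suc i + q ^ Suc i * X)"
    proof (rule mult_mono)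
      have "q ^ Suc i * 1 \<le> q ^ Suc i * X" if "q < \<beta>" using X(3)[OF that] pw by (intro mult_left_mono)
      moreover have "0 \<le> q ^ Suc i * X" using pw X by simp
      ultimately show "of_bool (q < \<beta>) \<le> 1 - q ^ Suc i + q ^ Suc i * X" using pw by auto
    qed (use le[of n] Suc in auto)
    then show ?thesis using 0 by simp
  next
    case (Suc j')
    have "n < m" using Suc.prems by simp
    then have thr: "run_in m B (Suc n) = Suc n" by (simp add: run_in_def)
    have "tilt (run_in m B) \<kappa> \<beta> q j n n = q * tilt (run_in m B) \<kappa> \<beta> q j' (Suc n) (Suc n) + (1 - q) * exp (\<kappa> * Suc n)"
      unfolding Suc tilt.simps thr by simp
    also have "\<dots> \<le> q * (exp (\<kappa> * m) * (1 - q ^ i + q ^ i * X)) + (1 - q) * exp (\<kappa> * m)"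
      using Suc.prems Suc q \<open>n < m\<close> by (intro add_mono mult_left_mono Suc.IH le) auto
    also have "\<dots> = exp (\<kappa> * m) * (1 - q ^ Suc i + q ^ Suc i * X)"
      by (simp add: algebra_simps)
    finally show ?thesis .
  qed
qed

section \<open>The rejection threshold\<close>

text \<open>The inverse of \<open>x \<mapsto> arccos (1 - 2 x)\<close>.\<close>

definition angle_mean :: "real \<Rightarrow> real" where
  "angle_mean \<phi> = (1 - cos \<phi>) / 2"

lemma sin_ge_min:
  assumes "0 \<le> lo" "lo \<le> \<phi>" "\<phi> \<le> hi" "hi \<le> pi"
  shows "min (sin lo) (sin hi) \<le> sin \<phi>"
proof (cases "\<phi> \<le> pi / 2")
  case True
  then have "sin lo \<le> sin \<phi>" using assms by (intro sin_monotone_2pi_le) auto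
  then show ?thesis by simp
next
  case False
  then have "sin (pi - hi) \<le> sin (pi - \<phi>)" using assms by (intro sin_monotone_2pi_le) auto
  then show ?thesis by simp
qed

lemma angle_mean_mono: "0 \<le> x \<Longrightarrow> x \<le> y \<Longrightarrow> y \<le> pi \<Longrightarrow> angle_mean x \<le> angle_mean y"
  unfolding angle_mean_def using cos_monotone_0_pi_le[of x y] by simp

lemma angle_mean_strict_mono: "0 \<le> x \<Longrightarrow> x < y \<Longrightarrow> y \<le> pi \<Longrightarrow> angle_mean x < angle_mean y"
  unfolding angle_mean_def using cos_monotone_0_pi[of x y] by simp

lemma angle_mean_bounds: "0 < x \<Longrightarrow> x < pi \<Longrightarrow> 0 < angle_mean x \<and> angle_mean x < 1"
  using angle_mean_strict_mono[of 0 x] angle_mean_strict_mono[of x pi]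
  by (simp add: angle_mean_def)

lemma angle_mean_variance: "angle_mean \<phi> * (1 - angle_mean \<phi>) = (sin \<phi>)\<^sup>2 / 4"
  unfolding angle_mean_def sin_squared_eq by (simp add: power2_eq_square field_simps)

text \<open>Taylor expansion in the first argument around \<open>t\<close>: value and slope vanish
  there, and the second derivative 1 / (z (1 - z)) is bounded below by comparing z (1 - z) with t (1
  - t).\<close>

lemma kl_ge_quadratic:
  assumes "0 < u" "u \<le> t" "t < 1"
  shows "(t - u)\<^sup>2 / (2 * (t * (1 - t) + (t - u))) \<le> kl u t"
proof (cases "u = t")
  case True
  then show ?thesis by (simp add: kl_def)
next
  case False
  define f where "f m x = (if m = 0 then kl x t else if m = 1 then ln x - ln (1 - x) - (ln t - ln (1 - t))
      else 1 / (x * (1 - x)))" for m :: nat and x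
  have "\<exists>z. u < z \<and> z < t \<and>
    kl u t = (\<Sum>m<2. (f m t / fact m) * (u - t) ^ m) + (f 2 z / fact 2) * (u - t) ^ 2"
  proof (rule Taylor_down[where b = t])
    show "f 0 = (\<lambda>x. kl x t)" by (simp add: f_def fun_eq_iff)
    show "\<forall>m z. m < 2 \<and> u \<le> z \<and> z \<le> t \<longrightarrow> (f m has_real_derivative f (Suc m) z) (at z)"
    proof (intro allI impI)
      fix m :: nat and z assume *: "m < 2 \<and> u \<le> z \<and> z \<le> t"
      then have z: "0 < z" "z < 1" using assms by auto
      have "((\<lambda>x. kl x t) has_real_derivative ln (z / t) - ln ((1 - z) / (1 - t))) (at z)"
      proof -
        have "(t - 1) / (1 - t) = - 1" using assms by (simp add: divide_simps)
        then show ?thesis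
          unfolding kl_def using z assms
          by (auto intro!: derivative_eq_intros simp: minus_divide_left[symmetric])
      qed
      then have "((\<lambda>x. kl x t) has_real_derivative ln z - ln (1 - z) - (ln t - ln (1 - t))) (at z)"
        using z assms by (simp add: ln_div algebra_simps)
      moreover have "((\<lambda>x. ln x - ln (1 - x) - (ln t - ln (1 - t))) has_real_derivative 1 / (z * (1 - z))) (at z)"
        using z by (auto intro!: derivative_eq_intros simp: divide_simps)
      moreover have "m = 0 \<or> m = 1" using * by auto
      ultimately show "(f m has_real_derivative f (Suc m) z) (at z)"
        by (auto simp: f_def[abs_def])
    qed
  qed (use assms False in auto)
  then obtain z where z: "u < z" "z < t" "kl u t = f 0 t + f 1 t * (u - t) + f 2 z / 2 * (u - t)\<^sup>2"
    by (auto simp: numeral_2_eq_2)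
  have v: "0 < z * (1 - z)" "z * (1 - z) \<le> t * (1 - t) + (t - u)"
  proof -
    have "z * (1 - z) - t * (1 - t) = (t - z) * (z + t - 1)" by (simp add: algebra_simps)
    also have "\<dots> \<le> (t - z) * 1" using z assms by (intro mult_left_mono) auto
    finally show "z * (1 - z) \<le> t * (1 - t) + (t - u)" using z by simp
  qed (use z assms in auto)
  have "(t - u)\<^sup>2 / (2 * (t * (1 - t) + (t - u))) \<le> (t - u)\<^sup>2 / (2 * (z * (1 - z)))"
    using v by (intro divide_left_mono) auto
  also have "\<dots> = kl u t"
    using z(3) assms by (simp add: f_def kl_def power2_commute)
  finally show ?thesis .
qed

text \<open>Cross entropy against the new mean is additive over samples and totals (n + 1) times the
  new entropy. The old samples contribute at least their own entropy, the new one its entropy plus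
  the relative entropy.\<close>

lemma entropy_increment:
  assumes t: "0 < b / n" "b / n < 1" "0 < (b + u) / (n + 1)" "(b + u) / (n + 1) < 1" and u: "0 < u" "u < 1"
    and n: "0 < n"
  shows "kl u ((b + u) / (n + 1)) \<le>
    (n + 1) * bin_entropy ((b + u) / (n + 1)) - n * bin_entropy (b / n) - bin_entropy u"
proof -
  define t where "t = (b + u) / (n + 1)"
  have bu: "b + u = (n + 1) * t" using n by (simp add: t_def)
  have t01: "0 < t" "t < 1" using assms by (simp_all add: t_def)
  have "0 \<le> n * kl (b / n) t" using kl_nonneg[of "b / n" t] assms t01 by simp
  also have "n * kl (b / n) t = - b * ln t - (n - b) * ln (1 - t) - n * bin_entropy (b / n)"
    using assms(1,2) t01 n by (simp add: kl_cross_entropy field_simps)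
  finally have "n * bin_entropy (b / n) \<le> - b * ln t - (n - b) * ln (1 - t)" by simp
  moreover have "(n + 1) * bin_entropy t = - (b + u) * ln t - (n + 1 - (b + u)) * ln (1 - t)"
    unfolding bu bin_entropy_def by (simp add: algebra_simps)
  moreover have "kl u t = - u * ln t - (1 - u) * ln (1 - t) - bin_entropy u"
    using u t01 by (rule kl_cross_entropy)
  ultimately show ?thesis unfolding t_def[symmetric] by (simp add: algebra_simps)
qed

section \<open>The threshold curve, its increments and its entropy gain\<close>

context
  fixes lo hi d \<delta> :: real and N :: nat
  assumes lo: "0 < lo" and hi: "hi < pi" and d: "0 < d"
    and range: "lo \<le> hi - d * ln (Suc N)" and \<delta>: "0 < \<delta>" "\<delta> < 1"
    and small: "d \<le> min (sin lo) (sin hi)" "4 * d \<le> \<delta> * (min (sin lo) (sin hi))\<^sup>2"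
begin

definition curve :: "real \<Rightarrow> real" where
  "curve t = t * angle_mean (hi - d * ln t)"

text \<open>The derivative of \<open>curve\<close> at \<open>t\<close>, as a function of the angle \<open>hi - d * ln t\<close>.\<close>

definition slope :: "real \<Rightarrow> real" where
  "slope \<phi> = angle_mean \<phi> - d * sin \<phi> / 2"

text \<open>These play the role of \<open>u\<close> in \<open>tilt_low\<close>. They telescope
  because the factor \<open>t\<close> makes \<open>curve 0 = 0\<close>, whatever value
  \<open>ln 0\<close> has.\<close>

definition incr :: "nat \<Rightarrow> real" where
  "incr n = curve n - curve (real n - 1)"

lemma sum_incr: "(\<Sum>s=1..n. incr s) = curve n"
  by (induction n) (simp_all add: incr_def curve_def)

lemma angle_range:
  fixes t :: real
  assumes "1 \<le> t" "t \<le> Suc N"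
  shows "lo \<le> hi - d * ln t" "hi - d * ln t \<le> hi"
proof -
  have "d * ln t \<le> d * ln (Suc N)" using assms d by (intro mult_left_mono) auto
  then show "lo \<le> hi - d * ln t" using range by simp
  show "hi - d * ln t \<le> hi" using assms d by simp
qed

lemma sin_range:
  assumes "lo \<le> \<phi>" "\<phi> \<le> hi"
  shows "min (sin lo) (sin hi) \<le> sin \<phi>"
  using assms lo hi by (intro sin_ge_min) auto

text \<open>Concavity of \<open>curve\<close>: the angle falls with time, and the derivative (sin
  \<phi> - d cos \<phi>) / 2 is nonnegative because \<open>d\<close> is at most every sine in the
  range.\<close>

lemma slope_mono:
  assumes "lo \<le> x" "x \<le> y" "y \<le> hi"
  shows "slope x \<le> slope y"
proof (rule DERIV_nonneg_imp_nondecreasing[OF \<open>x \<le> y\<close>])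
  fix \<phi> assume *: "x \<le> \<phi>" "\<phi> \<le> y"
  have "(slope has_real_derivative sin \<phi> / 2 - d * cos \<phi> / 2) (at \<phi>)"
    unfolding slope_def[abs_def] angle_mean_def by (auto intro!: derivative_eq_intros)
  moreover have "d * cos \<phi> \<le> sin \<phi>"
  proof -
    have "d * cos \<phi> \<le> d * 1" using d by (intro mult_left_mono) auto
    also have "\<dots> \<le> sin \<phi>" using sin_range[of \<phi>] small(1) * assms by linarith
    finally show ?thesis .
  qed
  ultimately show "\<exists>y. (slope has_real_derivative y) (at \<phi>) \<and> 0 \<le> y"
    by (intro exI[of _ "sin \<phi> / 2 - d * cos \<phi> / 2"]) auto
qed

lemma incr_slope:
  assumes "2 \<le> n"
  obtains \<xi> where "real n - 1 < \<xi>" "\<xi> < n" "incr n = slope (hi - d * ln \<xi>)"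
proof -
  have "\<exists>z>real n - 1. z < real n \<and> curve (real n) - curve (real n - 1) =
      (real n - (real n - 1)) * slope (hi - d * ln z)"
  proof (rule MVT2)
    fix x assume *: "real n - 1 \<le> x" "x \<le> real n"
    then have "0 < x" using assms by auto
    then show "(curve has_real_derivative slope (hi - d * ln x)) (at x)"
      unfolding curve_def[abs_def] slope_def angle_mean_def
      by (auto intro!: derivative_eq_intros simp: field_simps)
  qed auto
  then show ?thesis using that unfolding incr_def by auto
qed

lemma slope_le:
  assumes "lo \<le> \<phi>" "\<phi> \<le> hi"
  shows "slope \<phi> \<le> angle_mean hi" "angle_mean lo - d / 2 \<le> slope \<phi>"
proof -
  have "0 \<le> d * sin \<phi>" using d assms lo hi by (intro mult_nonneg_nonneg sin_ge_zero) auto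
  moreover have "d * sin \<phi> \<le> d * 1" using d by (intro mult_left_mono) auto
  moreover have "angle_mean \<phi> \<le> angle_mean hi" "angle_mean lo \<le> angle_mean \<phi>"
    using assms lo hi by (auto intro!: angle_mean_mono)
  ultimately show "slope \<phi> \<le> angle_mean hi" "angle_mean lo - d / 2 \<le> slope \<phi>"
    by (auto simp: slope_def)
qed

lemma incr_1: "incr 1 = angle_mean hi"
  by (simp add: incr_def curve_def)

lemma lo_le_hi: "lo \<le> hi"
  using angle_range[of 1] by simp

lemma incr_bounds:
  assumes "1 \<le> n" "n \<le> Suc N"
  shows "angle_mean lo - d / 2 \<le> incr n" "incr n \<le> angle_mean hi"
proof -
  have "angle_mean lo - d / 2 \<le> incr n \<and> incr n \<le> angle_mean hi"
  proof (cases "n = 1")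
    case True
    then show ?thesis using incr_1 lo_le_hi lo hi d angle_mean_mono[of lo hi] by auto
  next
    case False
    then obtain \<xi> where \<xi>: "real n - 1 < \<xi>" "\<xi> < n" "incr n = slope (hi - d * ln \<xi>)"
      using incr_slope[of n] assms by auto
    then have "1 \<le> \<xi>" "\<xi> \<le> Suc N" using assms False by auto
    then show ?thesis using slope_le angle_range \<xi> by simp
  qed
  then show "angle_mean lo - d / 2 \<le> incr n" "incr n \<le> angle_mean hi" by auto
qed

lemma incr_decreasing:
  assumes "1 \<le> n" "n \<le> N"
  shows "incr (Suc n) \<le> incr n"
\<comment> \<open>The mean value form starts at 2, away from the logarithm at 0; the first increment
  is the upper bound of all increments.\<close>
proof (cases "n = 1")
  case True
  then show ?thesis using incr_bounds[of 2] assms incr_1 by (simp add: numeral_2_eq_2)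
next
  case False
  obtain \<xi> where \<xi>: "real (Suc n) - 1 < \<xi>" "\<xi> < Suc n" "incr (Suc n) = slope (hi - d * ln \<xi>)"
    using incr_slope[of "Suc n"] assms by auto
  obtain \<zeta> where \<zeta>: "real n - 1 < \<zeta>" "\<zeta> < n" "incr n = slope (hi - d * ln \<zeta>)"
    using incr_slope[of n] assms False by auto
  have *: "1 \<le> \<zeta>" "\<zeta> \<le> \<xi>" "\<xi> \<le> Suc N" using \<xi> \<zeta> assms False by auto
  then have "d * ln \<zeta> \<le> d * ln \<xi>" using d by (intro mult_left_mono) auto
  then show ?thesis
    unfolding \<xi>(3) \<zeta>(3) using * angle_range[of \<xi>] angle_range[of \<zeta>] by (intro slope_mono) auto
qed

lemma curve_ratio:
  assumes "1 \<le> n"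
  shows "curve n / n = angle_mean (hi - d * ln n)"
  using assms by (simp add: curve_def)

text \<open>The increment lags behind the running mean t by about d sin \<phi> / 2, and t (1 - t) is
  (sin \<phi>)^2 / 4. So the lag squared over twice the variance is about d^2 / 2 at every angle;
  \<delta> absorbs the errors.\<close>

lemma kl_incr_ge:
  assumes n: "2 / \<delta> \<le> n" "n \<le> N" "1 \<le> n" and pos: "0 < angle_mean lo - d / 2"
  shows "(1 - \<delta>)\<^sup>2 * d\<^sup>2 / 2 \<le> kl (incr n) (curve n / n)"
proof -
  have "2 < 2 / \<delta>" using \<delta> by (simp add: field_simps)
  then have n2: "2 \<le> n" using n by linarith
  define s where "s = min (sin lo) (sin hi)"
  define \<phi> where "\<phi> t = hi - d * ln t" for t
  define t where "t = angle_mean (\<phi> n)"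
  have s: "0 < s" using lo hi lo_le_hi by (auto simp: s_def sin_gt_zero)
  have n1: "0 < real n - 1" "real (n - 1) = real n - 1" using n2 by auto
  have ang: "lo \<le> \<phi> n" "\<phi> n \<le> hi" "lo \<le> \<phi> (real n - 1)" "\<phi> (real n - 1) \<le> hi"
    unfolding \<phi>_def using angle_range[of n] angle_range[of "real n - 1"] n2 n by auto
  have gap: "\<phi> (real n - 1) - \<phi> n = d * ln (n / (real n - 1))"
    using n1 n2 by (simp add: \<phi>_def ln_div algebra_simps)
  have gap_le: "ln (n / (real n - 1)) \<le> 1 / (real n - 1)"
    using ln_le_minus_one[of "n / (real n - 1)"] n1 n2 by (simp add: field_simps)
  have gap_ge: "1 / n \<le> ln (n / (real n - 1))"
  proof -
    have "ln ((real n - 1) / n) \<le> (real n - 1) / n - 1" using n1 n2 by (intro ln_le_minus_one) auto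
    then show ?thesis using n1 n2 by (simp add: ln_div field_simps)
  qed
  have "0 < 1 / real n" using n2 by simp
  then have "0 < ln (n / (real n - 1))" using gap_ge by linarith
  then have "0 < d * ln (n / (real n - 1))" using d by simp
  then have lt: "\<phi> n < \<phi> (real n - 1)" unfolding gap[symmetric] by simp
  have "\<exists>z>\<phi> n. z < \<phi> (real n - 1) \<and> angle_mean (\<phi> (real n - 1)) - angle_mean (\<phi> n) =
     (\<phi> (real n - 1) - \<phi> n) * (sin z / 2)"
    by (rule MVT2[OF lt]) (auto simp: angle_mean_def intro!: derivative_eq_intros)
  then obtain z where z: "\<phi> n < z" "z < \<phi> (real n - 1)"
    "angle_mean (\<phi> (real n - 1)) - angle_mean (\<phi> n) = (\<phi> (real n - 1) - \<phi> n) * (sin z / 2)"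
    by auto
  have sz: "s \<le> sin z" "sin z \<le> 1" using sin_range[of z] z ang by (auto simp: s_def)
  define x where "x = t - incr n"
  \<comment> \<open>With running means t(n), the lag t(n) - (n t(n) - (n - 1) t(n - 1)) is n - 1
    times the drop of the running mean.\<close>
  have x: "x = (real n - 1) * (d * ln (n / (real n - 1)) * (sin z / 2))"
  proof -
    have "x = (real n - 1) * (angle_mean (\<phi> (real n - 1)) - angle_mean (\<phi> n))"
      unfolding x_def incr_def curve_def t_def \<phi>_def by (simp add: algebra_simps)
    then show ?thesis using z(3) gap by simp
  qed
  have x_le: "x \<le> d / 2"
  proof -
    have "x \<le> (real n - 1) * (d * (1 / (real n - 1)) * (1 / 2))"
      unfolding x using gap_le d n1 sz s by (intro mult_mono mult_left_mono) auto
    also have "\<dots> = d / 2" using n1 by (simp add: field_simps)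
    finally show ?thesis .
  qed
  have x_ge: "(1 - 1 / n) * d * sin z / 2 \<le> x"
  proof -
    have "(real n - 1) * (d * (1 / n) * (sin z / 2)) \<le> x"
      unfolding x using gap_ge d n1 sz s by (intro mult_mono mult_left_mono) auto
    moreover have "(real n - 1) * (d * (1 / n) * (sin z / 2)) = (1 - 1 / n) * d * sin z / 2"
      using n2 by (simp add: field_simps)
    ultimately show ?thesis by (simp only:)
  qed
  have "1 - \<delta> / 2 \<le> 1 - 1 / n" using n \<delta> n2 by (simp add: field_simps)
  then have "(1 - \<delta> / 2) * d * sin z / 2 \<le> (1 - 1 / n) * d * sin z / 2"
    using d sz s by (intro divide_right_mono mult_right_mono) auto
  with x_ge have x_ge: "(1 - \<delta> / 2) * d * sin z / 2 \<le> x" by linarith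
  have x_pos: "0 < (1 - \<delta> / 2) * d * sin z / 2" using \<delta> d sz s by simp
  have sin_close: "(sin (\<phi> n))\<^sup>2 \<le> (sin z)\<^sup>2 + 2 * d"
  proof -
    have "z - \<phi> n \<le> d"
    proof -
      have "\<phi> (real n - 1) - \<phi> n \<le> d * (1 / (real n - 1))"
        unfolding gap using gap_le d by (intro mult_left_mono) auto
      also have "\<dots> \<le> d * 1" using d n2 by (intro mult_left_mono) auto
      finally show ?thesis using z by simp
    qed
    moreover have "sin (\<phi> n) - sin z \<le> z - \<phi> n"
    proof -
      have "\<exists>w>\<phi> n. w < z \<and> sin z - sin (\<phi> n) = (z - \<phi> n) * cos w"
        by (rule MVT2[OF z(1)]) (auto intro!: derivative_eq_intros)
      then obtain w where "sin z - sin (\<phi> n) = (z - \<phi> n) * cos w" by auto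
      moreover have "(z - \<phi> n) * (- 1) \<le> (z - \<phi> n) * cos w" using z by (intro mult_left_mono) auto
      ultimately show ?thesis by simp
    qed
    ultimately have "sin (\<phi> n) - sin z \<le> d" by linarith
    moreover have "0 \<le> sin (\<phi> n)" "sin (\<phi> n) \<le> 1" using sin_range[of "\<phi> n"] ang s by (auto simp: s_def)
    moreover from this have "sin (\<phi> n) + sin z \<le> 2" using sz by linarith
    ultimately have "(sin (\<phi> n) - sin z) * (sin (\<phi> n) + sin z) \<le> d * 2"
      using sz s d by (intro mult_mono) auto
    then show ?thesis by (simp add: power2_eq_square algebra_simps)
  qed
  have t01: "0 < t" "t < 1" using angle_mean_bounds[of "\<phi> n"] ang lo hi by (auto simp: t_def)
  have inc: "0 < incr n" "incr n \<le> t" using incr_bounds[of n] n n2 pos x_ge x_pos by (auto simp: x_def)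
  \<comment> \<open>Of the error 4 d, one half comes from moving the sine from
    \<open>\<phi> n\<close> to \<open>z\<close> and one half from \<open>x \<le> d / 2\<close>. By
    \<open>small\<close> it amounts to a factor 1 + \<delta> on the squared sine.\<close>
  have "(1 - \<delta>)\<^sup>2 * d\<^sup>2 / 2 * (2 * (t * (1 - t) + x)) \<le> (1 - \<delta>)\<^sup>2 * d\<^sup>2 / 2 * (2 * ((sin z)\<^sup>2 + 4 * d) / 4)"
  proof (intro mult_left_mono)
    have "t * (1 - t) \<le> ((sin z)\<^sup>2 + 2 * d) / 4"
      unfolding t_def angle_mean_variance using sin_close by simp
    then show "2 * (t * (1 - t) + x) \<le> 2 * ((sin z)\<^sup>2 + 4 * d) / 4" using x_le by simp
  qed auto
  also have "\<dots> \<le> (1 - \<delta>)\<^sup>2 * d\<^sup>2 / 2 * (2 * ((sin z)\<^sup>2 * (1 + \<delta>)) / 4)"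
  proof -
    have "\<delta> * s\<^sup>2 \<le> \<delta> * (sin z)\<^sup>2" using \<delta> sz s by (intro mult_left_mono power_mono) auto
    then have "4 * d \<le> \<delta> * (sin z)\<^sup>2" using small by (simp add: s_def)
    then show ?thesis by (intro mult_left_mono divide_right_mono) (auto simp: algebra_simps)
  qed
  also have "\<dots> = ((1 - \<delta>)\<^sup>2 * (1 + \<delta>)) * (d * sin z / 2)\<^sup>2"
    by (simp add: power2_eq_square)
  also have "\<dots> \<le> (1 - \<delta> / 2)\<^sup>2 * (d * sin z / 2)\<^sup>2"
  proof (intro mult_right_mono)
    have "(1 - \<delta>)\<^sup>2 * (1 + \<delta>) = (1 - \<delta>) * (1 - \<delta>\<^sup>2)" by (simp add: power2_eq_square algebra_simps)
    also have "\<dots> \<le> (1 - \<delta>) * 1" using \<delta> by (intro mult_left_mono) auto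
    also have "\<dots> \<le> (1 - \<delta> / 2)\<^sup>2" by (simp add: power2_eq_square algebra_simps)
    finally show "(1 - \<delta>)\<^sup>2 * (1 + \<delta>) \<le> (1 - \<delta> / 2)\<^sup>2" .
  qed auto
  also have "\<dots> = ((1 - \<delta> / 2) * d * sin z / 2)\<^sup>2"
    by (simp add: power2_eq_square)
  also have "\<dots> \<le> x\<^sup>2" using x_ge x_pos by (intro power_mono) auto
  finally have "(1 - \<delta>)\<^sup>2 * d\<^sup>2 / 2 * (2 * (t * (1 - t) + x)) \<le> x\<^sup>2" .
  moreover have "0 < 2 * (t * (1 - t) + x)" using t01 x_ge x_pos by (intro mult_pos_pos add_pos_pos) auto
  ultimately have "(1 - \<delta>)\<^sup>2 * d\<^sup>2 / 2 \<le> x\<^sup>2 / (2 * (t * (1 - t) + x))"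
    by (simp only: pos_le_divide_eq)
  also have "\<dots> \<le> kl (incr n) t"
    unfolding x_def using inc t01 by (intro kl_ge_quadratic) auto
  finally show ?thesis using curve_ratio[of n] n by (simp add: t_def \<phi>_def)
qed

text \<open>Each step gains the relative entropy of the increment against the running mean, at least
  \<kappa> beyond \<open>n0\<close>. The earlier steps lose at most \<open>n0\<close> in total, a
  bound that does not grow with \<open>N\<close>.\<close>

lemma entropy_gain:
  assumes "1 \<le> n" "n \<le> N" and pos: "0 < angle_mean lo - d / 2" and n0: "2 / \<delta> \<le> n0"
    and \<kappa>: "\<kappa> = (1 - \<delta>)\<^sup>2 * d\<^sup>2 / 2" "\<kappa> \<le> 1"
  shows "\<kappa> * n - real n0 \<le> n * bin_entropy (curve n / n) - (\<Sum>s=1..n. bin_entropy (incr s))"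
proof -
  define E where "E n = n * bin_entropy (curve n / n) - (\<Sum>s=1..n. bin_entropy (incr s))" for n :: nat
  have \<kappa>0: "0 \<le> \<kappa>" unfolding \<kappa> by simp
  have "0 \<le> E n \<and> \<kappa> * n - real n0 \<le> E n"
    using assms(1,2)
  proof (induction n rule: nat_induct_at_least)
    case base
    have E1: "E 1 = 0" using incr_1 by (simp add: E_def curve_def)
    have "1 < 2 / \<delta>" using \<delta> by (simp add: field_simps)
    then show ?case using E1 n0 \<kappa> by auto
  next
    case (Suc n)
    have ratio: "0 < curve m / m \<and> curve m / m < 1" if "1 \<le> m" "m \<le> Suc N" for m :: nat
      using angle_mean_bounds[of "hi - d * ln m"] angle_range[of m] that lo hi by (simp add: curve_ratio)
    have u: "0 < incr (Suc n)" "incr (Suc n) < 1"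
      using incr_bounds[of "Suc n"] Suc pos angle_mean_bounds[of hi] lo_le_hi lo hi by auto
    have curve_Suc: "curve (Suc n) = curve n + incr (Suc n)" by (simp add: incr_def)
    have step: "kl (incr (Suc n)) (curve (Suc n) / Suc n) \<le> E (Suc n) - E n"
    proof -
      have "kl (incr (Suc n)) ((curve n + incr (Suc n)) / (real n + 1)) \<le>
        (real n + 1) * bin_entropy ((curve n + incr (Suc n)) / (real n + 1)) - n * bin_entropy (curve n / n) - bin_entropy (incr (Suc n))"
        using ratio[of n] ratio[of "Suc n"] u Suc
        by (intro entropy_increment) (auto simp: curve_Suc[symmetric] add.commute)
      then show ?thesis
        unfolding E_def curve_Suc by (simp add: add.commute)
    qed
    moreover have "0 \<le> kl (incr (Suc n)) (curve (Suc n) / Suc n)"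
      using u ratio[of "Suc n"] Suc by (intro kl_nonneg) auto
    ultimately have E0: "0 \<le> E (Suc n)" using Suc by auto
    show ?case
    proof (cases "Suc n \<le> n0")
      case True
      then have "\<kappa> * Suc n \<le> 1 * real n0" using \<kappa> \<kappa>0 by (intro mult_mono) auto
      then show ?thesis using E0 by auto
    next
      case False
      then have "\<kappa> \<le> kl (incr (Suc n)) (curve (Suc n) / Suc n)"
        unfolding \<kappa>(1) using n0 Suc pos by (intro kl_incr_ge) auto
      then show ?thesis using step Suc E0 by (auto simp: algebra_simps)
    qed
  qed
  then show ?thesis by (simp add: E_def)
qed

end

section \<open>Choice of the parameters\<close>

text \<open>Arms below \<open>b\<close> exceed 1 by at most b^m K before the factor exp (\<kappa>
  m), arms between \<open>b\<close> and \<alpha> do not exceed it, and arms from \<alpha> on fall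
  short by a multiple of \<alpha>^m. The condition on \<open>K\<close> lets the excess eat half of
  the average shortfall; the other half pays for exp (\<kappa> m).\<close>

lemma fail_prob_run_in:
  fixes a b \<alpha> \<beta> \<eta> \<kappa> K :: real
  assumes ab: "0 < a" "a < b" "b < \<alpha>" "\<alpha> < 1" "\<beta> \<le> b" and \<kappa>: "0 \<le> \<kappa>" "\<kappa> \<le> kl a b / 2"
    and B: "B 0 = 0" "\<And>n. 0 < n \<Longrightarrow> n \<le> N \<Longrightarrow> B n \<le> a * n"
    and low: "\<And>q j. 0 \<le> q \<Longrightarrow> q \<le> b \<Longrightarrow> j \<le> N \<Longrightarrow> tilt B \<kappa> \<beta> q j 0 0 \<le> K"
    and K: "1 \<le> K" "b ^ m * K \<le> \<eta> * \<alpha> ^ m * (1 - exp (- kl a b / 2)) / 2"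
    and m: "exp (\<kappa> * m) * (1 - \<eta> * \<alpha> ^ m * (1 - exp (- kl a b / 2)) / 2) \<le> 1"
    and \<mu>: "reservoir \<mu>" "\<eta> \<le> measure \<mu> {\<alpha>..}"
  shows "fail_prob (policy (run_in m B)) \<mu> N \<beta> \<le> exp (- \<kappa> * N)"
proof -
  define \<rho> where "\<rho> = exp (- kl a b / 2)"
  have "0 < kl a b" using ab by (intro kl_strict_pos) auto
  then have \<rho>: "0 < \<rho>" "\<rho> < 1" by (auto simp: \<rho>_def)
  have "tilt (run_in m B) \<kappa> \<beta> q j 0 0 \<le>
      exp (\<kappa> * m) * (1 + b ^ m * K) - exp (\<kappa> * m) * \<alpha> ^ m * (1 - \<rho>) * of_bool (\<alpha> \<le> q)"
    if q: "0 \<le> q" "q \<le> 1" and "j \<le> N" for q j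
  proof (cases "q < b")
    case True
    have "tilt (run_in m B) \<kappa> \<beta> q j 0 0 \<le> exp (\<kappa> * m) * (1 - q ^ m + q ^ m * K)"
      using True q \<kappa> K low \<open>j \<le> N\<close> by (intro tilt_run_in[where N = N]) auto
    also have "\<dots> \<le> exp (\<kappa> * m) * (1 + b ^ m * K)"
    proof -
      have "q ^ m * K \<le> b ^ m * K" using True q K by (intro mult_right_mono power_mono) auto
      moreover have "0 \<le> q ^ m" using q by simp
      ultimately show ?thesis by (intro mult_left_mono) (linarith, simp)
    qed
    finally show ?thesis using True ab by simp
  next
    case False
    have "tilt (run_in m B) \<kappa> \<beta> q j 0 0 \<le> exp (\<kappa> * m) * (1 - q ^ m + q ^ m * \<rho>)"
      using False q \<kappa> ab \<rho> B \<open>j \<le> N\<close> unfolding \<rho>_def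
      by (intro tilt_run_in[where N = N] tilt_high[where N = N and b = b]) auto
    also have "\<dots> = exp (\<kappa> * m) * (1 - q ^ m * (1 - \<rho>))" by (simp add: algebra_simps)
    also have "\<dots> \<le> exp (\<kappa> * m) * (1 + b ^ m * K - \<alpha> ^ m * (1 - \<rho>) * of_bool (\<alpha> \<le> q))"
    proof (intro mult_left_mono)
      have "0 \<le> b ^ m * K" using ab K by simp
      moreover have "\<alpha> ^ m * (1 - \<rho>) * of_bool (\<alpha> \<le> q) \<le> q ^ m * (1 - \<rho>)"
        using ab \<rho> q by (cases "\<alpha> \<le> q") (auto intro!: mult_right_mono power_mono)
      ultimately show "1 - q ^ m * (1 - \<rho>) \<le> 1 + b ^ m * K - \<alpha> ^ m * (1 - \<rho>) * of_bool (\<alpha> \<le> q)"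
        by linarith
    qed auto
    finally show ?thesis by (simp add: algebra_simps)
  qed
  moreover have "exp (\<kappa> * m) * (1 + b ^ m * K) - exp (\<kappa> * m) * \<alpha> ^ m * (1 - \<rho>) * \<eta> \<le> 1"
  proof -
    have "exp (\<kappa> * m) * (1 + b ^ m * K) \<le> exp (\<kappa> * m) * (1 + \<eta> * \<alpha> ^ m * (1 - \<rho>) / 2)"
      using K by (simp add: \<rho>_def)
    moreover have "exp (\<kappa> * m) * (1 + \<eta> * \<alpha> ^ m * (1 - \<rho>) / 2) - exp (\<kappa> * m) * \<alpha> ^ m * (1 - \<rho>) * \<eta> =
        exp (\<kappa> * m) * (1 - \<eta> * \<alpha> ^ m * (1 - \<rho>) / 2)" by (simp add: field_simps)
    ultimately show ?thesis using m unfolding \<rho>_def by linarith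
  qed
  ultimately show ?thesis
    unfolding fail_prob_policy[OF \<mu>(1)]
    using \<rho> ab \<mu> by (intro lose_mean_le[OF \<mu>(1), where N = N and \<alpha> = \<alpha> and \<eta> = \<eta>]) auto
qed

lemma policy_exponent:
  fixes \<alpha> \<beta> \<delta> \<eta> :: real
  assumes \<alpha>\<beta>: "0 < \<beta>" "\<beta> < \<alpha>" "\<alpha> < 1" and \<delta>: "0 < \<delta>" "\<delta> < 1 / 4" and \<eta>: "0 < \<eta>" "\<eta> < 1"
  shows "\<exists>c. \<forall>\<^sub>F N in sequentially. \<forall>\<mu>. reservoir \<mu> \<longrightarrow> \<eta> \<le> measure \<mu> {\<alpha>..} \<longrightarrow>
    fail_prob (policy (c N)) \<mu> N \<beta> \<le> exp (- ((1 - \<delta>)\<^sup>2 * (1 - 3 * \<delta>)\<^sup>2 * c_const \<alpha> \<beta> / (ln (real N))\<^sup>2) * real N)"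
proof -
  define \<phi> where "\<phi> x = arccos (1 - 2 * x)" for x
  have \<phi>_mean: "angle_mean (\<phi> x) = x" "0 < \<phi> x" "\<phi> x < pi" if "0 < x" "x < 1" for x
    using that arccos_lt_bounded[of "1 - 2 * x"] by (auto simp: \<phi>_def angle_mean_def)
  define D where "D = \<phi> \<alpha> - \<phi> \<beta>"
  have D: "0 < D" using \<alpha>\<beta> by (auto simp: D_def \<phi>_def intro!: arccos_less_arccos)
  \<comment> \<open>The margins keep the increments above \<beta> and leave room for
    \<open>b\<close> strictly between \<open>a\<close> and \<alpha>.\<close>
  define lo hi where "lo = \<phi> \<beta> + \<delta> * D" and "hi = \<phi> \<alpha> - \<delta> * D"
  have \<delta>D: "0 < \<delta> * D" "\<delta> * D < D / 4" using \<delta> D by auto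
  have lohi: "0 < lo" "lo < hi" "hi < pi" "\<phi> \<beta> < lo" "hi < \<phi> \<alpha>"
    using \<delta>D \<phi>_mean(2)[of \<beta>] \<phi>_mean(3)[of \<alpha>] \<alpha>\<beta> D by (auto simp: lo_def hi_def D_def)
  define a where "a = angle_mean hi"
  have "a < angle_mean (\<phi> \<alpha>)" unfolding a_def
    using lohi \<phi>_mean(3)[of \<alpha>] \<alpha>\<beta> by (intro angle_mean_strict_mono) auto
  then have a\<alpha>: "a < \<alpha>" using \<phi>_mean(1)[of \<alpha>] \<alpha>\<beta> by simp
  have "angle_mean (\<phi> \<beta>) < angle_mean lo" "angle_mean lo < angle_mean hi"
    using lohi \<phi>_mean(2)[of \<beta>] \<alpha>\<beta> by (auto intro!: angle_mean_strict_mono)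
  then have \<beta>lo: "\<beta> < angle_mean lo" "angle_mean lo < a" using \<phi>_mean(1)[of \<beta>] \<alpha>\<beta> by (auto simp: a_def)
  define b where "b = (a + \<alpha>) / 2"
  have b: "a < b" "b < \<alpha>" "\<beta> < b" "0 < a" using a\<alpha> \<beta>lo \<alpha>\<beta> by (auto simp: b_def)
  define s where "s = min (sin lo) (sin hi)"
  have s: "0 < s" using lohi by (auto simp: s_def sin_gt_zero)
  obtain n0 :: nat where n0: "2 / \<delta> \<le> n0" using real_arch_simple by blast
  define K where "K = exp (real n0 + 1 + \<bar>log_odds b\<bar> + \<bar>log_odds \<beta>\<bar>) / (1 - a)"
  have "1 * (1 - a) \<le> exp (real n0 + 1 + \<bar>log_odds b\<bar> + \<bar>log_odds \<beta>\<bar>)"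
    using b \<alpha>\<beta> by (intro order_trans[OF _ one_le_exp_iff[THEN iffD2]]) auto
  then have K: "1 \<le> K" using b \<alpha>\<beta> by (simp add: K_def pos_le_divide_eq)
  define \<rho> where "\<rho> = exp (- kl a b / 2)"
  have klpos: "0 < kl a b" using b \<alpha>\<beta> by (intro kl_strict_pos) auto
  then have \<rho>: "0 < \<rho>" "\<rho> < 1" by (auto simp: \<rho>_def)
  \<comment> \<open>As \<open>b < \<alpha>\<close>, a long enough run-in favours good arms by more
    than any constant. Like \<open>K\<close> and \<open>n0\<close>, \<open>m\<close> is fixed before
    \<open>N\<close>.\<close>
  obtain m where m: "(b / \<alpha>) ^ m < \<eta> * (1 - \<rho>) / 2 / K"
    using real_arch_pow_inv[of "\<eta> * (1 - \<rho>) / 2 / K" "b / \<alpha>"] \<eta> \<rho> K b \<alpha>\<beta> by auto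
  have \<alpha>m: "0 < \<alpha> ^ m" using \<alpha>\<beta> by simp
  have "b ^ m * K = (b / \<alpha>) ^ m * (\<alpha> ^ m * K)" using \<alpha>\<beta> by (simp add: power_divide)
  also have "\<dots> \<le> \<eta> * (1 - \<rho>) / 2 / K * (\<alpha> ^ m * K)"
    using m K \<alpha>m by (intro mult_right_mono) auto
  also have "\<dots> = \<eta> * \<alpha> ^ m * (1 - \<rho>) / 2" using K by simp
  finally have Km: "b ^ m * K \<le> \<eta> * \<alpha> ^ m * (1 - \<rho>) / 2" .
  define \<epsilon> where "\<epsilon> = \<eta> * \<alpha> ^ m * (1 - \<rho>) / 2"
  have \<epsilon>: "0 < \<epsilon>" using \<eta> \<alpha>\<beta> \<rho> by (simp add: \<epsilon>_def)
  \<comment> \<open>The available range is hi - lo = (1 - 2 \<delta>) D; the smaller factor 1 - 3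
    \<delta> makes up for ln (N + 1) exceeding ln N.\<close>
  define d where "d N = (1 - 3 * \<delta>) * D / ln (real N)" for N
  define \<kappa> where "\<kappa> N = (1 - \<delta>)\<^sup>2 * (d N)\<^sup>2 / 2" for N
  define c where "c N = run_in m (\<lambda>n. curve hi (d N) (real n))" for N
  have d0: "d \<longlonglongrightarrow> 0" unfolding d_def by real_asymp
  have "\<kappa> \<longlonglongrightarrow> (1 - \<delta>)\<^sup>2 * 0\<^sup>2 / 2" unfolding \<kappa>_def by (intro tendsto_intros d0) simp
  then have \<kappa>0: "\<kappa> \<longlonglongrightarrow> 0" by simp
  have "(\<lambda>N. exp (\<kappa> N * m) * (1 - \<epsilon>)) \<longlonglongrightarrow> exp (0 * real m) * (1 - \<epsilon>)"
    by (intro tendsto_intros \<kappa>0)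
  then have ev1: "\<forall>\<^sub>F N in sequentially. exp (\<kappa> N * m) * (1 - \<epsilon>) < 1"
    by (rule order_tendstoD) (use \<epsilon> in simp)
  have "(\<lambda>N. ln (real (Suc N)) / ln (real N)) \<longlonglongrightarrow> 1" by real_asymp
  then have ev2: "\<forall>\<^sub>F N in sequentially. ln (real (Suc N)) / ln (real N) < (1 - 2 * \<delta>) / (1 - 3 * \<delta>)"
    by (rule order_tendstoD) (use \<delta> in \<open>simp add: field_simps\<close>)
  have ev_d: "\<forall>\<^sub>F N in sequentially. d N < x" if "0 < x" for x
    using order_tendstoD(2)[OF d0 that] .
  have ev_\<kappa>: "\<forall>\<^sub>F N in sequentially. \<kappa> N < x" if "0 < x" for x
    using order_tendstoD(2)[OF \<kappa>0 that] .
  have \<delta>s: "0 < \<delta> * s\<^sup>2 / 4" and gap: "0 < angle_mean lo - \<beta>" and klpos2: "0 < kl a b / 2"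
    using \<delta> s \<beta>lo klpos by auto
  have "\<forall>\<^sub>F N in sequentially. \<forall>\<mu>. reservoir \<mu> \<longrightarrow> \<eta> \<le> measure \<mu> {\<alpha>..} \<longrightarrow>
    fail_prob (policy (c N)) \<mu> N \<beta> \<le> exp (- \<kappa> N * real N)"
    using ev1 ev2 ev_d[OF s] ev_d[OF \<delta>s] ev_d[OF gap] ev_\<kappa>[OF zero_less_one] ev_\<kappa>[OF klpos2]
      eventually_gt_at_top[of 1]
  proof eventually_elim
    case (elim N)
    have lnN: "0 < ln (real N)" using elim by simp
    have dN: "0 < d N" using lnN \<delta> D by (simp add: d_def)
    have range: "lo \<le> hi - d N * ln (Suc N)"
    proof -
      have "d N * ln (Suc N) = (1 - 3 * \<delta>) * D * (ln (Suc N) / ln N)" by (simp add: d_def)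
      also have "\<dots> \<le> (1 - 3 * \<delta>) * D * ((1 - 2 * \<delta>) / (1 - 3 * \<delta>))"
        using elim \<delta> D by (intro mult_left_mono) auto
      also have "\<dots> = hi - lo" using \<delta> by (simp add: lo_def hi_def D_def field_simps)
      finally show ?thesis by simp
    qed
    have small: "d N \<le> min (sin lo) (sin hi)" "4 * d N \<le> \<delta> * (min (sin lo) (sin hi))\<^sup>2"
      using elim \<delta> s by (simp_all add: s_def)
    have \<delta>1: "\<delta> < 1" using \<delta> by simp
    note curve_facts = lohi(1,3) dN range \<delta>(1) \<delta>1 small
    have pos: "\<beta> \<le> angle_mean lo - d N / 2" using elim dN \<delta> by auto
    have \<kappa>N: "0 \<le> \<kappa> N" by (simp add: \<kappa>_def)
    have sum: "(\<lambda>n. \<Sum>s=1..n. incr hi (d N) s) = (\<lambda>n. curve hi (d N) (real n))"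
      using sum_incr[OF curve_facts] by auto
    have inc: "\<beta> \<le> incr hi (d N) n \<and> incr hi (d N) n \<le> a" if "1 \<le> n" "n \<le> Suc N" for n
      using incr_bounds[OF curve_facts that] pos by (auto simp: a_def)
    have curve_le: "curve hi (d N) n \<le> a * n" if "n \<le> N" for n :: nat
    proof -
      have "(\<Sum>s=1..n. incr hi (d N) s) \<le> (\<Sum>s=1..n. a)" using inc that by (intro sum_mono) auto
      then show ?thesis using fun_cong[OF sum, of n] by (simp add: mult.commute)
    qed
    have low: "tilt (\<lambda>n. curve hi (d N) (real n)) (\<kappa> N) \<beta> q j 0 0 \<le> K"
      if "0 \<le> q" "q \<le> b" "j \<le> N" for q j
      unfolding sum[symmetric] K_def
    proof (rule tilt_low[where N = N])
      fix n assume "1 \<le> n" "n \<le> N"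
      then show "incr hi (d N) (Suc n) \<le> incr hi (d N) n" by (rule incr_decreasing[OF curve_facts])
      show "\<kappa> N * n - real n0 \<le> n * bin_entropy ((\<Sum>s=1..n. incr hi (d N) s) / n) - (\<Sum>s=1..n. bin_entropy (incr hi (d N) s))"
        unfolding fun_cong[OF sum]
        using \<open>1 \<le> n\<close> \<open>n \<le> N\<close> pos \<alpha>\<beta> n0 elim by (intro entropy_gain[OF curve_facts]) (auto simp: \<kappa>_def)
    qed (use that b \<alpha>\<beta> inc \<kappa>N elim in auto)
    show ?case
      unfolding c_def
    proof (intro allI impI fail_prob_run_in[where a = a and b = b and \<alpha> = \<alpha> and \<eta> = \<eta> and K = K] low)
      show "curve hi (d N) (real 0) = 0" by (simp add: curve_def[OF curve_facts])
    qed (use b \<alpha>\<beta> \<kappa>N elim K Km curve_le \<epsilon>_def in \<open>auto simp: \<rho>_def\<close>)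
  qed
  moreover have "\<kappa> N = (1 - \<delta>)\<^sup>2 * (1 - 3 * \<delta>)\<^sup>2 * c_const \<alpha> \<beta> / (ln (real N))\<^sup>2" for N
    by (simp add: \<kappa>_def d_def c_const_def D_def \<phi>_def power_mult_distrib power_divide)
  ultimately show ?thesis by auto
qed

section \<open>Diagonal choice of the policies along a subsequence\<close>

theorem theorem1p6:
  fixes \<alpha> \<beta> :: real
  assumes "0 < \<beta>" "\<beta> < \<alpha>" "\<alpha> < 1"
  shows "\<exists>A :: nat \<Rightarrow> alg. \<forall>\<eta> :: real. \<forall>\<mu> :: nat \<Rightarrow> real measure.
           0 < \<eta> \<and> \<eta> < 1 \<and> (\<forall>N\<ge>1. reservoir (\<mu> N) \<and> Ginv (\<mu> N) (1 - \<eta>) \<ge> \<alpha>) \<longrightarrow>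
           limsup (\<lambda>N. neglog (fail_prob (A N) (\<mu> N) N \<beta>) * ereal ((ln (real N))\<^sup>2 / real N))
             \<ge> ereal (c_const \<alpha> \<beta>)"
proof -
  \<comment> \<open>The shift by 5 keeps \<open>\<delta> k\<close> below 1/4. The same number serves
    as the loss in the exponent and as the assumed mass of good arms.\<close>
  define \<delta> where "\<delta> k = 1 / (real k + 5)" for k :: nat
  define r where "r k = (1 - \<delta> k)\<^sup>2 * (1 - 3 * \<delta> k)\<^sup>2 * c_const \<alpha> \<beta>" for k
  have "\<forall>k. \<exists>c. \<forall>\<^sub>F N in sequentially. \<forall>\<mu>. reservoir \<mu> \<longrightarrow> \<delta> k \<le> measure \<mu> {\<alpha>..} \<longrightarrow>
    fail_prob (policy (c N)) \<mu> N \<beta> \<le> exp (- (r k / (ln (real N))\<^sup>2) * real N)"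
    unfolding r_def using assms by (intro allI policy_exponent) (auto simp: \<delta>_def)
  from choice[OF this] obtain c where c: "\<And>k. \<forall>\<^sub>F N in sequentially. \<forall>\<mu>. reservoir \<mu> \<longrightarrow> \<delta> k \<le> measure \<mu> {\<alpha>..} \<longrightarrow>
    fail_prob (policy (c k N)) \<mu> N \<beta> \<le> exp (- (r k / (ln (real N))\<^sup>2) * real N)"
    by blast
  \<comment> \<open>The limit superior only sees a subsequence, so letting \<open>idx\<close> take every value infinitely often
    allows the policies to be tuned to arbitrarily small \<open>\<eta>\<close> and \<open>\<delta>\<close>.\<close>
  define idx where "idx N = fst (prod_decode N)" for N
  have idx: "\<exists>\<^sub>F N in sequentially. idx N = k" for k
    unfolding frequently_sequentially
  proof
    fix n
    have "n \<le> prod_encode (k, n)" by (rule le_prod_encode_2)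
    then show "\<exists>N\<ge>n. idx N = k" by (intro exI[of _ "prod_encode (k, n)"]) (simp add: idx_def)
  qed
  have \<delta>0: "\<delta> \<longlonglongrightarrow> 0" unfolding \<delta>_def by real_asymp
  have r: "r \<longlonglongrightarrow> c_const \<alpha> \<beta>"
  proof -
    have "r \<longlonglongrightarrow> (1 - 0)\<^sup>2 * (1 - 3 * 0)\<^sup>2 * c_const \<alpha> \<beta>" unfolding r_def by (intro tendsto_intros \<delta>0)
    then show ?thesis by simp
  qed
  show ?thesis
  proof (intro exI[of _ "\<lambda>N. policy (c (idx N) N)"] allI impI)
    fix \<eta> :: real and \<mu> :: "nat \<Rightarrow> real measure"
    assume *: "0 < \<eta> \<and> \<eta> < 1 \<and> (\<forall>N\<ge>1. reservoir (\<mu> N) \<and> Ginv (\<mu> N) (1 - \<eta>) \<ge> \<alpha>)"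
    show "limsup (\<lambda>N. neglog (fail_prob (policy (c (idx N) N)) (\<mu> N) N \<beta>) * ereal ((ln (real N))\<^sup>2 / real N))
             \<ge> ereal (c_const \<alpha> \<beta>)"
    proof (rule dense_le)
      fix y assume y: "y < ereal (c_const \<alpha> \<beta>)"
      have "\<forall>\<^sub>F k in sequentially. y < ereal (r k)"
        using y r by (intro order_tendstoD(1)[of "\<lambda>k. ereal (r k)"]) auto
      moreover have "\<forall>\<^sub>F k in sequentially. \<delta> k < \<eta>"
        using * by (intro order_tendstoD(2)[OF \<delta>0]) auto
      ultimately have "\<exists>k. y < ereal (r k) \<and> \<delta> k < \<eta>"
        by (intro eventually_happens'[OF sequentially_bot] eventually_conj)
      then obtain k where k: "y < ereal (r k)" "\<delta> k < \<eta>" by auto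
      have "\<forall>\<^sub>F N in sequentially. idx N = k \<longrightarrow>
          y < neglog (fail_prob (policy (c (idx N) N)) (\<mu> N) N \<beta>) * ereal ((ln (real N))\<^sup>2 / real N)"
        using c[of k] eventually_gt_at_top[of 1]
      proof eventually_elim
        case (elim N)
        define f where "f = fail_prob (policy (c k N)) (\<mu> N) N \<beta>"
        have lnN: "0 < ln (real N)" using elim by simp
        have w: "0 < (ln (real N))\<^sup>2 / real N" using elim lnN by simp
        \<comment> \<open>The policy is tuned to mass \<open>\<delta> k\<close> without knowing
          \<eta>; it applies because the true mass is at least \<eta>, which exceeds
          \<open>\<delta> k\<close>.\<close>
        have "\<delta> k \<le> measure (\<mu> N) {\<alpha>..}"
          using reservoir_good_mass[of "\<mu> N" \<alpha> \<eta>] * k elim by auto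
        then have f: "f \<le> exp (- (r k / (ln (real N))\<^sup>2) * real N)"
          using elim * by (auto simp: f_def)
        have f0: "0 \<le> f" unfolding f_def fail_prob_def by simp
        have "y < neglog f * ereal ((ln (real N))\<^sup>2 / real N)"
        proof (cases "f = 0")
          case True
          have "neglog f * ereal ((ln (real N))\<^sup>2 / real N) = \<infinity>"
            using True elim lnN by (simp add: neglog_def)
          moreover have "y < \<infinity>" using k(1) by (cases y) auto
          ultimately show ?thesis by (simp only:)
        next
          case False
          then have "ln f \<le> ln (exp (- (r k / (ln (real N))\<^sup>2) * real N))"
            using f f0 by (subst ln_le_cancel_iff) auto
          then have "ln f \<le> - (r k / (ln (real N))\<^sup>2) * real N" by (simp only: ln_exp)
          then have "r k / (ln (real N))\<^sup>2 * real N * ((ln (real N))\<^sup>2 / real N) \<le> - ln f * ((ln (real N))\<^sup>2 / real N)"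
            using w by (intro mult_right_mono) auto
          moreover have "r k / (ln (real N))\<^sup>2 * real N * ((ln (real N))\<^sup>2 / real N) = r k"
            using lnN elim by simp
          ultimately have "ereal (r k) \<le> neglog f * ereal ((ln (real N))\<^sup>2 / real N)"
            using False by (simp add: neglog_def)
          with k(1) show ?thesis by (rule less_le_trans)
        qed
        then show ?case by (simp add: f_def)
      qed
      then have freq: "\<exists>\<^sub>F N in sequentially.
          y < neglog (fail_prob (policy (c (idx N) N)) (\<mu> N) N \<beta>) * ereal ((ln (real N))\<^sup>2 / real N)"
        using idx[of k] by (rule frequently_rev_mp[rotated])
      show "y \<le> limsup (\<lambda>N. neglog (fail_prob (policy (c (idx N) N)) (\<mu> N) N \<beta>) * ereal ((ln (real N))\<^sup>2 / real N))"
      proof (rule ccontr)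
        assume "\<not> ?thesis"
        then have "\<forall>\<^sub>F N in sequentially.
          neglog (fail_prob (policy (c (idx N) N)) (\<mu> N) N \<beta>) * ereal ((ln (real N))\<^sup>2 / real N) < y"
          by (intro Limsup_lessD) simp
        then have "\<forall>\<^sub>F N in sequentially.
          \<not> y < neglog (fail_prob (policy (c (idx N) N)) (\<mu> N) N \<beta>) * ereal ((ln (real N))\<^sup>2 / real N)"
          by eventually_elim auto
        then show False using freq by (simp add: frequently_def)
      qed
    qed
  qed
qed

end
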